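(* If the univariate binomial basis conjecture holds, then $\#\mathsf P\neq\#\mathsf P^{\mathsf{NP}}$ (and hence, in particular, $\mathsf P\neq\mathsf{NP}$).
   Context: $\#\mathsf P$ is the class of functions $f:\{0,1\}^*\to\mathbb N$ such that there is a nondeterministic polynomial-time Turing machine whose number of accepting computation paths on every input $w$ equals $f(w)$; for an oracle language $A$, $\#\mathsf P^A$ is defined with machines having oracle access to $A$, and $\#\mathsf P^{\mathsf{NP}}$ denotes the functions counting accepting paths of nondeterministic polynomial-time machines with access to an $\mathsf{NP}$ oracle. A univariate polynomial $\psi\in\mathbb Q[x]$ is a closure property of $\#\mathsf P$ if $\psi\circ f\in\#\mathsf P$ for all $f\in\#\mathsf P$; it relativizes if $\psi\circ f\in\#\mathsf P^A$ for every oracle $A$ and every $f\in\#\mathsf P^A$. The univariate binomial basis conjecture states: every univariate polynomial closure property of $\#\mathsf P$ relativizes. *)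

theory Defs
  imports Complex_Main "HOL-Computational_Algebra.Polynomial"
begin

type_synonym word = "bool list"

text \<open>
  States and tape symbols are natural numbers; a machine uses only finitely many of each,
  because its set of rules is finite. The symbol 0 is the blank. A tape is infinite in both
  directions and is given by its cell contents and its head position.
\<close>

type_synonym tape = "(int \<Rightarrow> nat) \<times> int"
type_synonym config = "nat \<times> tape list"

datatype dir = MoveLeft | Stay | MoveRight

fun shift :: "dir \<Rightarrow> int" where
  "shift MoveLeft = -1"
| "shift Stay = 0"
| "shift MoveRight = 1"

text \<open>
  A rule \<open>(q, rs, q', as)\<close> applies in state \<open>q\<close> when the heads read the symbols \<open>rs\<close>;
  the machine then enters \<open>q'\<close> and performs on each tape the corresponding action of \<open>as\<close>, a
  symbol to write followed by a head move. The field \<open>oracle_states\<close> is \<open>None\<close> for a machine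
  without oracle, and \<open>Some (query, yes, no)\<close> for an oracle machine.
\<close>

type_synonym rule = "nat \<times> nat list \<times> nat \<times> (nat \<times> dir) list"

record machine =
  num_tapes :: nat
  start_state :: nat
  accept_state :: nat
  oracle_states :: "(nat \<times> nat \<times> nat) option"
  rules :: "rule set"

text \<open>
  Tape 0 is the input tape and tape 1 the query tape of an oracle machine. No rule leaves the
  accepting state or the query state, so an accepting configuration is halting and the answer
  of the oracle is the only successor of a query. Every other configuration to which no rule
  applies is halting and rejecting.
\<close>

definition wf_machine :: "machine \<Rightarrow> bool" where
  "wf_machine M \<longleftrightarrow>
     num_tapes M \<ge> 1 \<and> finite (rules M) \<and>
     (\<forall>(q, rs, q', as) \<in> rules M.
        length rs = num_tapes M \<and> length as = num_tapes M \<and> q \<noteq> accept_state M) \<and>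
     (case oracle_states M of
        None \<Rightarrow> True
      | Some (query, yes, no) \<Rightarrow>
          num_tapes M \<ge> 2 \<and> query \<noteq> accept_state M \<and>
          (\<forall>(q, rs, q', as) \<in> rules M. q \<noteq> query))"

definition oracle_free :: "machine \<Rightarrow> bool" where
  "oracle_free M \<longleftrightarrow> oracle_states M = None"

definition deterministic :: "machine \<Rightarrow> bool" where
  "deterministic M \<longleftrightarrow>
     (\<forall>q rs q1 as1 q2 as2. (q, rs, q1, as1) \<in> rules M \<longrightarrow> (q, rs, q2, as2) \<in> rules M \<longrightarrow>
        q1 = q2 \<and> as1 = as2)"

fun read_tape :: "tape \<Rightarrow> nat" where
  "read_tape (t, h) = t h"

fun act :: "nat \<times> dir \<Rightarrow> tape \<Rightarrow> tape" where
  "act (s, d) (t, h) = (t(h := s), h + shift d)"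

definition bit_symbol :: "bool \<Rightarrow> nat" where
  "bit_symbol b = (if b then 2 else 1)"

definition blank_tape :: tape where
  "blank_tape = (\<lambda>_. 0, 0)"

definition input_tape :: "word \<Rightarrow> tape" where
  "input_tape w =
     (\<lambda>i. if 0 \<le> i \<and> i < int (length w) then bit_symbol (w ! nat i) else 0, 0)"

definition initial_config :: "machine \<Rightarrow> word \<Rightarrow> config" where
  "initial_config M w =
     (start_state M, input_tape w # replicate (num_tapes M - 1) blank_tape)"

text \<open>
  The word queried is the one written on the cells 0, 1, 2, \<dots> up to the first cell whose
  symbol is not a bit. The position of the head is irrelevant.
\<close>

fun query_word :: "tape \<Rightarrow> word" where
  "query_word (t, h) =
     map (\<lambda>i. t (int i) = bit_symbol True)
       [0..<(LEAST n. t (int n) \<notin> range bit_symbol)]"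

text \<open>An oracle call is a single step that leaves all tapes unchanged.\<close>

inductive step :: "machine \<Rightarrow> word set \<Rightarrow> config \<Rightarrow> config \<Rightarrow> bool"
  for M :: machine and A :: "word set" where
  apply_rule: "(q, map read_tape ts, q', as) \<in> rules M \<Longrightarrow>
     step M A (q, ts) (q', map2 act as ts)"
| oracle_call: "oracle_states M = Some (q, yes, no) \<Longrightarrow>
     step M A (q, ts) (if query_word (ts ! 1) \<in> A then yes else no, ts)"

text \<open>
  Paths need not be maximal. Since head positions are absolute, different rules
  lead to different successor configurations, so counting sequences of configurations is
  the same as counting sequences of nondeterministic choices.
\<close>

definition computation_paths :: "machine \<Rightarrow> word set \<Rightarrow> word \<Rightarrow> config list set" where
  "computation_paths M A w =
     {cs. cs \<noteq> [] \<and> hd cs = initial_config M w \<and> successively (step M A) cs}"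

definition accepting_paths :: "machine \<Rightarrow> word set \<Rightarrow> word \<Rightarrow> config list set" where
  "accepting_paths M A w = {cs \<in> computation_paths M A w. fst (last cs) = accept_state M}"

text \<open>The path \<open>cs\<close> has \<open>length cs - 1\<close> steps.\<close>

definition poly_time :: "machine \<Rightarrow> word set \<Rightarrow> bool" where
  "poly_time M A \<longleftrightarrow>
     (\<exists>p :: nat poly. \<forall>w. \<forall>cs \<in> computation_paths M A w. length cs - 1 \<le> poly p (length w))"

text \<open>
  For oracle-free machines the oracle argument of \<open>poly_time\<close> and \<open>accepting_paths\<close> is
  irrelevant; the empty set serves as a dummy.
\<close>

definition class_P :: "word set set" where
  "class_P = {L. \<exists>M. wf_machine M \<and> oracle_free M \<and> deterministic M \<and> poly_time M {} \<and>
     L = {w. accepting_paths M {} w \<noteq> {}}}"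

definition class_NP :: "word set set" where
  "class_NP = {L. \<exists>M. wf_machine M \<and> oracle_free M \<and> poly_time M {} \<and>
     L = {w. accepting_paths M {} w \<noteq> {}}}"

definition sharpP :: "(word \<Rightarrow> nat) set" where
  "sharpP = {f. \<exists>M. wf_machine M \<and> oracle_free M \<and> poly_time M {} \<and>
     f = (\<lambda>w. card (accepting_paths M {} w))}"

definition sharpP_oracle :: "word set \<Rightarrow> (word \<Rightarrow> nat) set" where
  "sharpP_oracle A = {f. \<exists>M. wf_machine M \<and> poly_time M A \<and>
     f = (\<lambda>w. card (accepting_paths M A w))}"

definition sharpP_NP :: "(word \<Rightarrow> nat) set" where
  "sharpP_NP = (\<Union>A\<in>class_NP. sharpP_oracle A)"

text \<open>
  \<open>\<psi> \<circ> f\<close> is a priori rational-valued; membership in a class of functions with values in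
  the natural numbers includes that all its values are natural numbers.
\<close>

definition comp_in :: "rat poly \<Rightarrow> (word \<Rightarrow> nat) \<Rightarrow> (word \<Rightarrow> nat) set \<Rightarrow> bool" where
  "comp_in \<psi> f C \<longleftrightarrow> (\<exists>g\<in>C. \<forall>w. poly \<psi> (of_nat (f w)) = of_nat (g w))"

definition closure_property :: "rat poly \<Rightarrow> bool" where
  "closure_property \<psi> \<longleftrightarrow> (\<forall>f\<in>sharpP. comp_in \<psi> f sharpP)"

definition relativizes :: "rat poly \<Rightarrow> bool" where
  "relativizes \<psi> \<longleftrightarrow> (\<forall>A. \<forall>f\<in>sharpP_oracle A. comp_in \<psi> f (sharpP_oracle A))"

definition univariate_binomial_basis_conjecture :: bool where
  "univariate_binomial_basis_conjecture \<longleftrightarrow> (\<forall>\<psi>. closure_property \<psi> \<longrightarrow> relativizes \<psi>)"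

lemma finite_step:
  assumes "wf_machine M"
  shows "finite {c'. step M A c c'}"
proof -
  obtain q ts where c: "c = (q, ts)" by (cases c)
  let ?F = "\<lambda>(q, rs, q', as). (q', map2 act as ts)"
  let ?G = "case oracle_states M of None \<Rightarrow> {} | Some (_, y, n) \<Rightarrow> {(y, ts), (n, ts)}"
  have "{c'. step M A c c'} \<subseteq> ?F ` rules M \<union> ?G"
    unfolding c by (force elim!: step.cases intro: rev_image_eqI)
  moreover have "finite (?F ` rules M \<union> ?G)"
    using assms by (auto simp: wf_machine_def split: option.splits prod.splits)
  ultimately show ?thesis by (rule finite_subset)
qed

lemma finite_accepting_paths:
  assumes wf: "wf_machine M" and pt: "poly_time M A"
  shows "finite (accepting_paths M A w)"
proof -
  let ?P = "\<lambda>n. {cs \<in> computation_paths M A w. length cs = Suc n}"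
  have fin: "finite (?P n)" for n
  proof (induction n)
    case 0
    have "?P 0 \<subseteq> {[initial_config M w]}"
      by (auto simp: computation_paths_def length_Suc_conv)
    then show ?case by (rule finite_subset) simp
  next
    case (Suc n)
    have "?P (Suc n) \<subseteq> (\<Union>cs\<in>?P n. (\<lambda>c. cs @ [c]) ` {c. step M A (last cs) c})"
    proof
      fix cs assume cs: "cs \<in> ?P (Suc n)"
      then obtain ds c where ds: "cs = ds @ [c]" by (cases cs rule: rev_cases) auto
      with cs have "ds \<noteq> []" by auto
      with cs ds have "ds \<in> ?P n" "step M A (last ds) c"
        by (auto simp: computation_paths_def successively_append_iff)
      with ds show "cs \<in> (\<Union>cs\<in>?P n. (\<lambda>c. cs @ [c]) ` {c. step M A (last cs) c})"
        by blast
    qed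
    moreover have "finite (\<Union>cs\<in>?P n. (\<lambda>c. cs @ [c]) ` {c. step M A (last cs) c})"
      using Suc finite_step[OF wf] by blast
    ultimately show ?case by (rule finite_subset)
  qed
  obtain p where p: "\<And>cs. cs \<in> computation_paths M A w \<Longrightarrow> length cs - 1 \<le> poly p (length w)"
    using pt unfolding poly_time_def by blast
  have "accepting_paths M A w \<subseteq> (\<Union>n\<le>poly p (length w). ?P n)"
  proof
    fix cs assume "cs \<in> accepting_paths M A w"
    then have cs: "cs \<in> computation_paths M A w" by (simp add: accepting_paths_def)
    then have "length cs = Suc (length cs - 1)" by (cases cs) (auto simp: computation_paths_def)
    with cs p[OF cs] show "cs \<in> (\<Union>n\<le>poly p (length w). ?P n)" by blast
  qed
  then show ?thesis by (rule finite_subset) (use fin in blast)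
qed

end

theory Submission
  imports Defs "HOL-Library.Nat_Bijection" "HOL-Library.Countable"
begin

text \<open>
  The polynomial \<open>\<psi>(x) = x - C(x, 2) + C(x, 3)\<close> has a negative coefficient in the binomial basis
  and does not relativize: an oracle \<open>A\<close> is built by diagonalization such that \<open>\<psi>\<close> applied to the
  number of words of length \<open>|w|\<close> in \<open>A\<close> is not in the relativized class. The values of \<open>\<psi>\<close> at
  0, 1, 2 are 0, 1, 1, and a machine that makes few queries cannot avoid having two accepting
  paths for some pair of words if it has one for every single word.

  Either of the two collapses puts the characteristic function of every NP language into \<open>sharpP\<close>,
  and then \<open>\<psi>\<close> is a closure property: \<open>\<psi>(x) = [x > 0] + C(x - 1, 3)\<close> with truncated subtraction.
  Order the accepting paths of a machine for \<open>f\<close> lexicographically. The rank of a path is a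
  \<open>sharpP\<close> function of the pair of input and path, because the paths that precede a given one can be
  guessed. Hence \<open>S(0) + \<dots> + S(f - 1)\<close>, the sum of \<open>S\<close> over the ranks, is in \<open>sharpP\<close> if \<open>S\<close>
  preserves \<open>sharpP\<close>. Starting with \<open>S(r) = r\<close> this yields \<open>C(x, 2)\<close> and \<open>C(x, 3)\<close>, and starting
  with the NP predicate \<open>[r > 0]\<close> it yields \<open>x - 1\<close>.
\<close>

section \<open>Counting accepting paths recursively\<close>

text \<open>The coefficient of \<open>C(x, 2)\<close> is \<psi>(2) - 2 \<psi>(1) + \<psi>(0) = -1: a
  second word in the oracle must not add a second path. Only the values at 0, 1, 2 matter for the
  diagonalization. The term \<open>C(x, 3)\<close> is there because x - C(x, 2) alone is negative at
  4, and because it gives \<psi>(m + 1) = 1 + C(m, 3), whose only subtraction is m = x - 1.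
  Subtracting 1 means discarding the first accepting path, and not being the first is an NP
  condition. A collapse to \<open>sharpP_NP\<close> helps because an NP language can be queried as
  its own oracle; P = NP helps because a deterministic machine has at most one accepting path. The
  technical obstacle is that paths are sequences of configurations, so two choices that lead to the
  same configuration would be counted once. Hence the care for distinct successors in every
  construction. Ranks, in turn, need paths that can be compared and handed to another machine as
  words, hence the detour through bit strings.\<close>

declare split_paired_All [simp del] split_paired_Ex [simp del]

text \<open>Bundles a time bound and an exact path count, so that a machine is verified one
  transition at a time, without handling lists of configurations. A halting rejecting configuration
  costs one unit of time, since it falls under \<open>branching\<close> with an empty sum.\<close>

inductive runs :: "machine \<Rightarrow> word set \<Rightarrow> config \<Rightarrow> nat \<Rightarrow> nat \<Rightarrow> bool"
  for M :: machine and A :: "word set" where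
  accepting: "fst c = accept_state M \<Longrightarrow> runs M A c n (Suc 0)"
| branching: "fst c \<noteq> accept_state M \<Longrightarrow> (\<And>c'. step M A c c' \<Longrightarrow> runs M A c' n (\<kappa> c')) \<Longrightarrow>
     runs M A c (Suc n) (\<Sum>c' | step M A c c'. \<kappa> c')"

lemma runs_mono: "runs M A c n k \<Longrightarrow> n \<le> m \<Longrightarrow> runs M A c m k"
proof (induction arbitrary: m rule: runs.induct)
  case (accepting c n)
  then show ?case by (intro runs.accepting)
next
  case (branching c n \<kappa>)
  then obtain m' where m: "m = Suc m'" "n \<le> m'" by (cases m) auto
  show ?case unfolding m(1)
    by (rule runs.branching) (use branching m(2) in auto)
qed

lemma runs_one:
  assumes "fst c \<noteq> accept_state M" "{c'. step M A c c'} = {d}" "runs M A d n k"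
  shows "runs M A c (Suc n) k"
proof -
  have "runs M A c' n k" if "step M A c c'" for c'
  proof -
    have "c' = d" using that assms(2) by blast
    then show ?thesis using assms(3) by simp
  qed
  from runs.branching[OF assms(1) this] show ?thesis unfolding assms(2) by simp
qed

lemma runs_two:
  assumes "fst c \<noteq> accept_state M" "{c'. step M A c c'} = {d, e}" "d \<noteq> e"
    "runs M A d n k" "runs M A e n l"
  shows "runs M A c (Suc n) (k + l)"
proof -
  have "runs M A c (Suc n) (\<Sum>c' | step M A c c'. if c' = d then k else l)"
  proof (rule runs.branching[OF assms(1)])
    fix c' assume "step M A c c'"
    then have "c' = d \<or> c' = e" using assms(2) by blast
    then show "runs M A c' n (if c' = d then k else l)" using assms by auto
  qed
  then show ?thesis unfolding assms(2) using assms(3) by simp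
qed

lemma runs_dead:
  assumes "fst c \<noteq> accept_state M" "{c'. step M A c c'} = {}"
  shows "runs M A c (Suc n) 0"
proof -
  have "runs M A c (Suc n) (\<Sum>c' | step M A c c'. 0)"
    by (rule runs.branching[OF assms(1)]) (use assms(2) in blast)
  then show ?thesis by simp
qed

lemma accepting_no_step: "wf_machine M \<Longrightarrow> fst c = accept_state M \<Longrightarrow> \<not> step M A c c'"
  by (auto simp: wf_machine_def elim!: step.cases split: option.splits)

definition paths_from :: "machine \<Rightarrow> word set \<Rightarrow> config \<Rightarrow> config list set" where
  "paths_from M A c = {cs. cs \<noteq> [] \<and> hd cs = c \<and> successively (step M A) cs}"

definition accepting_from :: "machine \<Rightarrow> word set \<Rightarrow> config \<Rightarrow> config list set" where
  "accepting_from M A c = {cs \<in> paths_from M A c. fst (last cs) = accept_state M}"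

lemma paths_from_unfold:
  "paths_from M A c = insert [c] (\<Union>c'\<in>{c'. step M A c c'}. (#) c ` paths_from M A c')"
proof -
  have "cs \<in> paths_from M A c \<longleftrightarrow>
      cs = [c] \<or> (\<exists>c' ds. step M A c c' \<and> ds \<in> paths_from M A c' \<and> cs = c # ds)" for cs
  proof (cases cs)
    case (Cons d ds)
    then show ?thesis by (cases ds) (auto simp: paths_from_def)
  qed (auto simp: paths_from_def)
  then show ?thesis by blast
qed

lemma paths_from_Cons:
  assumes "step M A c c'" "ds \<in> paths_from M A c'"
  shows "c # ds \<in> paths_from M A c"
  using assms by (cases ds) (auto simp: paths_from_def)

lemma paths_from_cases:
  assumes "cs \<in> paths_from M A c"
  obtains "cs = [c]" | c' ds where "step M A c c'" "ds \<in> paths_from M A c'" "cs = c # ds"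
proof -
  have "cs = [c] \<or> (\<exists>c' ds. step M A c c' \<and> ds \<in> paths_from M A c' \<and> cs = c # ds)"
    using assms unfolding paths_from_unfold[of M A c] by (elim insertE UN_E imageE CollectE) metis+
  then show ?thesis using that by metis
qed

lemma accepting_from_accept:
  assumes "wf_machine M" "fst c = accept_state M"
  shows "accepting_from M A c = {[c]}" "paths_from M A c = {[c]}"
proof -
  show "paths_from M A c = {[c]}"
  proof -
    have "{c'. step M A c c'} = {}" using accepting_no_step[OF assms] by simp
    then show ?thesis unfolding paths_from_unfold[of M A c] by (simp only: UN_empty)
  qed
  then have "cs \<in> accepting_from M A c \<longleftrightarrow> cs = [c]" for cs
    unfolding accepting_from_def mem_Collect_eq using assms(2) by (metis last.simps singleton_iff)
  then show "accepting_from M A c = {[c]}" by (intro set_eqI) simp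
qed

lemma accepting_from_unfold:
  assumes "fst c \<noteq> accept_state M"
  shows "accepting_from M A c = (\<Union>c'\<in>{c'. step M A c c'}. (#) c ` accepting_from M A c')"
    (is "_ = ?R")
proof -
  have last: "last (c # ds) = last ds" if "ds \<in> paths_from M A c'" for c' ds
    using that by (auto simp: paths_from_def)
  then have "accepting_from M A c =
      {cs \<in> (\<Union>c'\<in>{c'. step M A c c'}. (#) c ` paths_from M A c'). fst (last cs) = accept_state M}"
    unfolding accepting_from_def by (subst paths_from_unfold) (use assms in force)
  also have "\<dots> = ?R"
  proof (rule set_eqI)
    fix cs
    show "cs \<in> {cs \<in> (\<Union>c'\<in>{c'. step M A c c'}. (#) c ` paths_from M A c'). fst (last cs) = accept_state M}
      \<longleftrightarrow> cs \<in> ?R"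
      unfolding accepting_from_def mem_Collect_eq UN_iff image_iff bex_simps
      using last by metis
  qed
  finally show ?thesis .
qed

text \<open>The second configuration of a path reveals the branch it belongs to, so the branches
  contribute disjoint sets.\<close>

lemma card_accepting_from:
  assumes "wf_machine M" "fst c \<noteq> accept_state M"
    and fin: "\<And>c'. step M A c c' \<Longrightarrow> finite (accepting_from M A c')"
  shows "card (accepting_from M A c) = (\<Sum>c' | step M A c c'. card (accepting_from M A c'))"
proof -
  have hd: "hd ds = c'" if "ds \<in> accepting_from M A c'" for ds c'
    using that by (simp add: accepting_from_def paths_from_def)
  have "card (accepting_from M A c) =
      (\<Sum>c' | step M A c c'. card ((#) c ` accepting_from M A c'))"
    unfolding accepting_from_unfold[OF assms(2)]
  proof (rule card_UN_disjoint)
    show "\<forall>d\<in>{c'. step M A c c'}. \<forall>e\<in>{c'. step M A c c'}. d \<noteq> e \<longrightarrow>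
        (#) c ` accepting_from M A d \<inter> (#) c ` accepting_from M A e = {}"
      using hd by blast
  qed (use fin finite_step[OF assms(1)] in blast)+
  also have "\<dots> = (\<Sum>c' | step M A c c'. card (accepting_from M A c'))"
    by (simp add: card_image)
  finally show ?thesis .
qed

lemma runs_paths:
  assumes wf: "wf_machine M" and "runs M A c n k"
  shows "(\<forall>cs\<in>paths_from M A c. length cs - 1 \<le> n) \<and> finite (accepting_from M A c) \<and>
    card (accepting_from M A c) = k"
  using assms(2)
proof (induction rule: runs.induct)
  case (accepting c n)
  then show ?case using accepting_from_accept[OF wf] by simp
next
  case (branching c n \<kappa>)
  have "length cs - 1 \<le> Suc n" if "cs \<in> paths_from M A c" for cs
    using that
  proof (cases rule: paths_from_cases)
    case (2 c' ds)
    then have "length ds - 1 \<le> n" using branching.IH by metis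
    then show ?thesis using 2 by simp
  qed simp
  moreover have "finite (accepting_from M A c)"
    unfolding accepting_from_unfold[OF branching(1)] using branching finite_step[OF wf] by auto
  moreover have "card (accepting_from M A c) = (\<Sum>c' | step M A c c'. \<kappa> c')"
    using card_accepting_from[OF wf branching(1)] branching by simp
  ultimately show ?case by blast
qed

text \<open>The extra unit of time is for dead ends, which take no step but are charged by
  \<open>branching\<close>.\<close>

lemma paths_runs:
  assumes wf: "wf_machine M" and "\<forall>cs\<in>paths_from M A c. length cs - 1 \<le> n"
  shows "runs M A c (Suc n) (card (accepting_from M A c))"
  using assms(2)
proof (induction n arbitrary: c)
  case 0
  show ?case
  proof (cases "fst c = accept_state M")
    case True
    then show ?thesis using accepting_from_accept[OF wf] by (simp add: runs.accepting)
  next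
    case False
    have none: "\<not> step M A c c'" for c'
    proof
      assume "step M A c c'"
      then have "[c, c'] \<in> paths_from M A c" by (simp add: paths_from_def)
      with 0 have "length [c, c'] - 1 \<le> 0" by (rule bspec)
      then show False by simp
    qed
    have "accepting_from M A c = {}" using accepting_from_unfold[OF False] none by blast
    moreover have "{c'. step M A c c'} = {}" using none by blast
    ultimately show ?thesis using runs_dead[OF False] by simp
  qed
next
  case (Suc n)
  show ?case
  proof (cases "fst c = accept_state M")
    case True
    then show ?thesis using accepting_from_accept[OF wf] by (simp add: runs.accepting)
  next
    case False
    have sub: "runs M A c' (Suc n) (card (accepting_from M A c'))" if "step M A c c'" for c'
    proof (rule Suc.IH, rule ballI)
      fix cs assume cs: "cs \<in> paths_from M A c'"
      have "length (c # cs) - 1 \<le> Suc n"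
        using Suc.prems paths_from_Cons[OF that cs] by (rule bspec)
      then show "length cs - 1 \<le> n" by simp
    qed
    have "finite (accepting_from M A c')" if "step M A c c'" for c'
      using runs_paths[OF wf sub[OF that]] by blast
    then have "card (accepting_from M A c) = (\<Sum>c' | step M A c c'. card (accepting_from M A c'))"
      by (rule card_accepting_from[OF wf False])
    with runs.branching[OF False sub] show ?thesis by simp
  qed
qed

lemma poly_nat_mono: "m \<le> n \<Longrightarrow> poly (p :: nat poly) m \<le> poly p n"
  by (induction p) (simp_all add: mult_le_mono)

lemma computation_paths_eq: "computation_paths M A w = paths_from M A (initial_config M w)"
  by (simp add: computation_paths_def paths_from_def)

lemma accepting_paths_eq: "accepting_paths M A w = accepting_from M A (initial_config M w)"
  by (simp add: accepting_paths_def accepting_from_def computation_paths_eq)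

lemma poly_time_runs:
  assumes "wf_machine M" "poly_time M A"
  shows "\<exists>p :: nat poly. \<forall>w. runs M A (initial_config M w) (poly p (length w)) (card (accepting_paths M A w))"
proof -
  obtain p :: "nat poly" where
    "\<And>w cs. cs \<in> computation_paths M A w \<Longrightarrow> length cs - 1 \<le> poly p (length w)"
    using assms(2) unfolding poly_time_def by blast
  then have "runs M A (initial_config M w) (Suc (poly p (length w))) (card (accepting_paths M A w))" for w
    unfolding accepting_paths_eq by (intro paths_runs assms(1)) (simp add: computation_paths_eq)
  then have "\<forall>w. runs M A (initial_config M w) (poly (p + 1) (length w))
      (card (accepting_paths M A w))"
    by simp
  then show ?thesis by blast
qed

lemma runs_poly_time:
  assumes "wf_machine M"
    "\<And>w. runs M A (initial_config M w) (poly p (length w)) (f w)"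
  shows "poly_time M A" "card (accepting_paths M A w) = f w"
proof -
  have *: "(\<forall>cs\<in>computation_paths M A w. length cs - 1 \<le> poly p (length w)) \<and>
      card (accepting_paths M A w) = f w" for w
    using runs_paths[OF assms] by (simp add: accepting_paths_eq computation_paths_eq)
  show "poly_time M A" unfolding poly_time_def using * by (intro exI[of _ p] allI) simp
  show "card (accepting_paths M A w) = f w" using * by simp
qed

lemma sharpP_iff:
  "f \<in> sharpP \<longleftrightarrow> (\<exists>M. wf_machine M \<and> oracle_free M \<and>
     (\<exists>p :: nat poly. \<forall>w. runs M {} (initial_config M w) (poly p (length w)) (f w)))"
  (is "_ \<longleftrightarrow> ?R")
proof
  assume "f \<in> sharpP"
  then obtain M where "wf_machine M" "oracle_free M" "poly_time M {}"
    "f = (\<lambda>w. card (accepting_paths M {} w))"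
    by (auto simp: sharpP_def)
  then show ?R using poly_time_runs by blast
next
  assume ?R
  then obtain M and p :: "nat poly" where M: "wf_machine M" "oracle_free M"
    "\<And>w. runs M {} (initial_config M w) (poly p (length w)) (f w)" by blast
  have "poly_time M {}" "f = (\<lambda>w. card (accepting_paths M {} w))"
    using runs_poly_time[OF M(1,3)] by auto
  then show "f \<in> sharpP" unfolding sharpP_def using M by blast
qed

lemma sharpP_oracleI:
  assumes "wf_machine M"
    "\<And>w. runs M A (initial_config M w) (poly p (length w)) (f w)"
  shows "f \<in> sharpP_oracle A"
proof -
  have "poly_time M A" "f = (\<lambda>w. card (accepting_paths M A w))"
    using runs_poly_time[OF assms] by auto
  then show ?thesis unfolding sharpP_oracle_def using assms(1) by blast
qed

section \<open>Embeddings of machines, and tapes that hold a word\<close>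

definition embed_step :: "tape list \<Rightarrow> nat \<times> (nat \<times> dir) list \<Rightarrow> config" where
  "embed_step ts = (\<lambda>(q', as). (q', map2 act as ts))"

lemma succs_oracle_free:
  assumes "oracle_states M = None"
  shows "{c'. step M A (q, ts) c'} =
    embed_step ts ` {(q', as). (q, map read_tape ts, q', as) \<in> rules M}"
  using assms by (force simp: embed_step_def elim: step.cases intro: step.apply_rule)

text \<open>The cell under the old head shows the symbol written, and the new head position shows
  the move. So different rules never merge into one successor.\<close>

lemma act_inj: "act a t = act b t \<Longrightarrow> a = b"
proof (cases a; cases b; cases t)
  fix s d s' d' f h
  assume "act a t = act b t" "a = (s, d)" "b = (s', d')" "t = (f, h)"
  then have "f(h := s) = f(h := s')" "shift d = shift d'" by auto
  then have "s = s'" "d = d'"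
    by (metis fun_upd_same) (use \<open>shift d = shift d'\<close> in \<open>cases d; cases d'; simp\<close>)
  then show "a = b" using \<open>a = (s, d)\<close> \<open>b = (s', d')\<close> by simp
qed

lemma map2_act_inj:
  "map2 act as ts = map2 act bs ts \<Longrightarrow> length as = length ts \<Longrightarrow> length bs = length ts \<Longrightarrow> as = bs"
proof (induction ts arbitrary: as bs)
  case (Cons t ts)
  then obtain a as' b bs' where "as = a # as'" "bs = b # bs'" by (metis length_Suc_conv)
  with Cons show ?case by (auto dest: act_inj)
qed simp

text \<open>Serves to run one machine as a component of another. The invariant \<open>I\<close> will
  fix the number of tapes.\<close>

lemma runs_embed:
  assumes "runs M A c n k" and "I c"
    and step: "\<And>c. I c \<Longrightarrow> fst c \<noteq> accept_state M \<Longrightarrow>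
       {c'. step M' A' (E c) c'} = E ` {c'. step M A c c'}"
    and acc: "\<And>c. I c \<Longrightarrow> fst (E c) = accept_state M' \<longleftrightarrow> fst c = accept_state M"
    and inv: "\<And>c c'. I c \<Longrightarrow> step M A c c' \<Longrightarrow> I c'"
    and inj: "inj_on E {c. I c}"
  shows "runs M' A' (E c) n k"
  using assms(1,2)
proof (induction rule: runs.induct)
  case (accepting c n)
  then show ?case using acc by (simp add: runs.accepting)
next
  case (branching c n \<kappa>)
  have injc: "inj_on E {c'. step M A c c'}"
    by (rule inj_on_subset[OF inj]) (use inv branching.prems in blast)
  \<comment> \<open>\<open>branching\<close> wants the counts as a function of the target
    successors, so \<open>\<kappa>\<close> is transported along the inverse of
    \<open>E\<close>.\<close>
  have "runs M' A' (E c) (Suc n) (\<Sum>d | step M' A' (E c) d. \<kappa> (the_inv_into {c'. step M A c c'} E d))"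
  proof (rule runs.branching)
    show "fst (E c) \<noteq> accept_state M'" using branching acc by simp
    fix d assume "step M' A' (E c) d"
    then obtain c' where c': "d = E c'" "step M A c c'" using step branching by blast
    then show "runs M' A' d n (\<kappa> (the_inv_into {c'. step M A c c'} E d))"
      using branching inv by (simp add: the_inv_into_f_f[OF injc])
  qed
  also have "(\<Sum>d | step M' A' (E c) d. \<kappa> (the_inv_into {c'. step M A c c'} E d))
      = (\<Sum>c' | step M A c c'. \<kappa> c')"
    unfolding step[OF branching.prems branching(1)] sum.reindex[OF injc]
    by (rule sum.cong) (simp_all add: the_inv_into_f_f[OF injc])
  finally show ?case .
qed

lemma act_stay: "act (read_tape t, Stay) t = t"
  by (cases t) simp

definition tape_of :: "word \<Rightarrow> int \<Rightarrow> tape" where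
  "tape_of w h = (fst (input_tape w), h)"

lemma input_tape_eq: "input_tape w = tape_of w 0"
  by (simp add: tape_of_def input_tape_def)

lemma blank_tape_eq: "blank_tape = tape_of [] 0"
  by (simp add: tape_of_def input_tape_def blank_tape_def fun_eq_iff)

lemma read_tape_of:
  "read_tape (tape_of w h) = (if 0 \<le> h \<and> h < int (length w) then bit_symbol (w ! nat h) else 0)"
  by (simp add: tape_of_def input_tape_def)

lemma read_blank [simp]: "read_tape blank_tape = 0"
  by (simp add: blank_tape_def)

lemma act_keep: "r = read_tape (tape_of w h) \<Longrightarrow> act (r, d) (tape_of w h) = tape_of w (h + shift d)"
  by (auto simp: tape_of_def input_tape_def fun_eq_iff)

lemma act_append:
  "act (bit_symbol b, d) (tape_of w (int (length w))) = tape_of (w @ [b]) (int (length w) + shift d)"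
  by (auto simp: tape_of_def input_tape_def nth_append fun_eq_iff nat_less_iff)

lemma bit_symbol_neq_0 [simp]: "bit_symbol b \<noteq> 0" "0 \<noteq> bit_symbol b"
  by (simp_all add: bit_symbol_def)

lemma bit_symbol_inj [simp]: "bit_symbol b = bit_symbol b' \<longleftrightarrow> b = b'"
  by (simp add: bit_symbol_def)

lemma length_step:
  "step M A c c' \<Longrightarrow> wf_machine M \<Longrightarrow> length (snd c) = num_tapes M \<Longrightarrow> length (snd c') = num_tapes M"
  by (fastforce simp: wf_machine_def elim!: step.cases)

section \<open>A normal form with binary choices\<close>

type_synonym trans = "bool \<Rightarrow> nat \<times> nat list \<Rightarrow> (nat \<times> (nat \<times> dir) list) option"

definition nxt :: "trans \<Rightarrow> bool \<Rightarrow> config \<Rightarrow> config option" where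
  "nxt \<delta> b c = map_option (embed_step (snd c)) (\<delta> b (fst c, map read_tape (snd c)))"

fun leads :: "trans \<Rightarrow> nat \<Rightarrow> config \<Rightarrow> word \<Rightarrow> bool" where
  "leads \<delta> a c [] \<longleftrightarrow> fst c = a"
| "leads \<delta> a c (b # u) \<longleftrightarrow> (\<exists>c'. nxt \<delta> b c = Some c' \<and> leads \<delta> a c' u)"

text \<open>The optional configuration lets the recursion in \<open>witnesses_Some\<close> treat a
  missing successor like an empty branch.\<close>

definition witnesses :: "trans \<Rightarrow> nat \<Rightarrow> config option \<Rightarrow> word set" where
  "witnesses \<delta> a co = (case co of None \<Rightarrow> {} | Some c \<Rightarrow> {u. leads \<delta> a c u})"

text \<open>The single rule is also the base case, since its premise is vacuous for a configuration
  without successors. The bound is therefore always positive.\<close>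

inductive halts :: "trans \<Rightarrow> config \<Rightarrow> nat \<Rightarrow> bool" for \<delta> :: trans where
  "(\<And>b c'. nxt \<delta> b c = Some c' \<Longrightarrow> halts \<delta> c' n) \<Longrightarrow> halts \<delta> c (Suc n)"

definition start_tapes :: "nat \<Rightarrow> word \<Rightarrow> tape list" where
  "start_tapes k w = input_tape w # replicate (k - 1) blank_tape"

text \<open>\<open>q0 \<noteq> q1\<close> keeps the two successors apart as configurations, whatever
  tapes are attached. \<open>s \<noteq> a\<close> makes every witness nonempty, so a machine that
  logs the choices can recognise acceptance in the step that enters \<open>a\<close>.\<close>

definition normal_form :: "nat \<Rightarrow> trans \<Rightarrow> nat \<Rightarrow> nat \<Rightarrow> bool" where
  "normal_form k \<delta> s a \<longleftrightarrow> k \<ge> 1 \<and> s \<noteq> a \<and>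
     (\<forall>b. finite (dom (\<delta> b))) \<and>
     (\<forall>b q rs q' as. \<delta> b (q, rs) = Some (q', as) \<longrightarrow>
        length rs = k \<and> length as = k \<and> q \<noteq> a) \<and>
     (\<forall>x q0 as0 q1 as1. \<delta> False x = Some (q0, as0) \<longrightarrow> \<delta> True x = Some (q1, as1) \<longrightarrow> q0 \<noteq> q1)"

lemma halts_mono: "halts \<delta> c n \<Longrightarrow> n \<le> m \<Longrightarrow> halts \<delta> c m"
proof (induction arbitrary: m rule: halts.induct)
  case (1 c n)
  then obtain m' where "m = Suc m'" "n \<le> m'" by (cases m) auto
  with 1 show ?case by (auto intro: halts.intros)
qed

lemma witnesses_None [simp]: "witnesses \<delta> a None = {}"
  by (simp add: witnesses_def)

lemma witnesses_Some:
  "witnesses \<delta> a (Some c) = (if fst c = a then {[]} else {}) \<union>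
     ((#) False ` witnesses \<delta> a (nxt \<delta> False c) \<union> (#) True ` witnesses \<delta> a (nxt \<delta> True c))"
proof -
  have "u \<in> witnesses \<delta> a (Some c) \<longleftrightarrow> u \<in> (if fst c = a then {[]} else {}) \<union>
     ((#) False ` witnesses \<delta> a (nxt \<delta> False c) \<union> (#) True ` witnesses \<delta> a (nxt \<delta> True c))" for u
  proof (cases u)
    case Nil
    then show ?thesis by (auto simp: witnesses_def)
  next
    case (Cons b v)
    then show ?thesis by (cases b) (auto simp: witnesses_def split: option.splits)
  qed
  then show ?thesis by blast
qed

lemma length_witness:
  "halts \<delta> c n \<Longrightarrow> u \<in> witnesses \<delta> a (Some c) \<Longrightarrow> length u \<le> n"
proof (induction arbitrary: u rule: halts.induct)
  case (1 c n)
  then show ?case by (cases u) (auto simp: witnesses_def)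
qed

lemma finite_witnesses: "halts \<delta> c n \<Longrightarrow> finite (witnesses \<delta> a (Some c))"
proof (rule finite_subset)
  show "finite {u :: word. set u \<subseteq> UNIV \<and> length u \<le> n}"
    by (rule finite_lists_length_le) simp
qed (use length_witness in blast)

lemma card_witnesses:
  assumes "fst c \<noteq> a" "finite (witnesses \<delta> a (nxt \<delta> False c))" "finite (witnesses \<delta> a (nxt \<delta> True c))"
  shows "card (witnesses \<delta> a (Some c)) =
    card (witnesses \<delta> a (nxt \<delta> False c)) + card (witnesses \<delta> a (nxt \<delta> True c))"
proof -
  have "card ((#) False ` witnesses \<delta> a (nxt \<delta> False c) \<union> (#) True ` witnesses \<delta> a (nxt \<delta> True c)) =
      card ((#) False ` witnesses \<delta> a (nxt \<delta> False c)) + card ((#) True ` witnesses \<delta> a (nxt \<delta> True c))"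
    using assms by (intro card_Un_disjoint) auto
  then show ?thesis unfolding witnesses_Some[of \<delta> a c] using assms(1) by (simp add: card_image)
qed

text \<open>\<open>Suc\<close> reserves 0 for the additional start state.\<close>

definition scan_state :: "nat \<Rightarrow> nat \<Rightarrow> nat" where
  "scan_state q j = Suc (prod_encode (q, j))"

lemma scan_state_eq [simp]: "scan_state q j = scan_state q' j' \<longleftrightarrow> q = q' \<and> j = j'"
  "scan_state q j \<noteq> 0" "0 \<noteq> scan_state q j"
  by (simp_all add: scan_state_def)

definition keep :: "nat list \<Rightarrow> (nat \<times> dir) list" where
  "keep = map (\<lambda>r. (r, Stay))"

lemma length_keep [simp]: "length (keep rs) = length rs"
  by (simp add: keep_def)

lemma map2_act_keep [simp]: "map2 act (keep (map read_tape ts)) ts = ts"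
  by (induction ts) (simp_all add: keep_def act_stay)

text \<open>
  The normal form tries the rules one after the other: in the state \<open>scan_state q j\<close>, the
  choice \<open>False\<close> applies the rule number \<open>j\<close>, and the choice \<open>True\<close> proceeds to the next one. The
  additional initial step makes sure that the start state is not accepting.
\<close>

definition scan_trans :: "nat \<Rightarrow> nat \<Rightarrow> rule list \<Rightarrow> trans" where
  "scan_trans k s rl b = (\<lambda>(x, rs).
     if x = 0 then
       if \<not> b \<and> rs \<in> (\<lambda>r. r # replicate (k - 1) 0) ` {..2} then Some (scan_state s 0, keep rs) else None
     else (case prod_decode (x - 1) of (q, j) \<Rightarrow>
       if b then
         if j < length rl \<and> (\<exists>q' as. (q, rs, q', as) \<in> set rl)
         then Some (scan_state q (Suc j), keep rs) else None
       else
         if j < length rl \<and> fst (rl ! j) = q \<and> fst (snd (rl ! j)) = rs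
         then Some (scan_state (fst (snd (snd (rl ! j)))) 0, snd (snd (snd (rl ! j)))) else None))"

lemma scan_trans_start:
  "scan_trans k s rl b (0, rs) =
     (if \<not> b \<and> rs \<in> (\<lambda>r. r # replicate (k - 1) 0) ` {..2} then Some (scan_state s 0, keep rs) else None)"
  by (simp add: scan_trans_def)

lemma scan_trans_True:
  "scan_trans k s rl True (scan_state q j, rs) =
     (if j < length rl \<and> (\<exists>q' as. (q, rs, q', as) \<in> set rl)
      then Some (scan_state q (Suc j), keep rs) else None)"
  by (simp add: scan_trans_def scan_state_def)

lemma scan_trans_False:
  "scan_trans k s rl False (scan_state q j, rs) =
     (if j < length rl \<and> fst (rl ! j) = q \<and> fst (snd (rl ! j)) = rs
      then Some (scan_state (fst (snd (snd (rl ! j)))) 0, snd (snd (snd (rl ! j)))) else None)"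
  by (simp add: scan_trans_def scan_state_def)

lemma state_cases: obtains "x = 0" | q j where "x = scan_state q j"
  by (metis scan_state_def not0_implies_Suc prod_decode_inverse surj_pair)

text \<open>The guards in \<open>scan_trans\<close> make its domain finite: the initial step is
  restricted to readings of a start tape, with a symbol among 0, 1, 2, and the choice
  \<open>True\<close> to readings that occur in some rule.\<close>

lemma normal_form_scan_trans:
  assumes wf: "wf_machine M" and rl: "set rl = rules M"
  shows "normal_form (num_tapes M) (scan_trans (num_tapes M) (start_state M) rl) 0 (scan_state (accept_state M) 0)"
proof -
  let ?k = "num_tapes M"
  let ?\<delta> = "scan_trans ?k (start_state M) rl"
  have k: "?k \<ge> 1" and rule: "\<And>q rs q' as. (q, rs, q', as) \<in> set rl \<Longrightarrow>
      length rs = ?k \<and> length as = ?k \<and> q \<noteq> accept_state M"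
    using wf rl by (auto simp: wf_machine_def)
  let ?D = "{0} \<times> (\<lambda>r. r # replicate (?k - 1) 0) ` {..2} \<union>
    (\<lambda>(j, r). (scan_state (fst r) j, fst (snd r))) ` ({..<length rl} \<times> set rl)"
  have "finite (dom (?\<delta> b))" for b
  proof (rule finite_subset)
    show "dom (?\<delta> b) \<subseteq> ?D"
    proof
      fix y assume y: "y \<in> dom (?\<delta> b)"
      obtain x rs where xrs: "y = (x, rs)" by (cases y)
      show "y \<in> ?D"
      proof (cases x rule: state_cases)
        case 1
        with y xrs show ?thesis by (auto simp: scan_trans_start split: if_splits)
      next
        case (2 q j)
        have "j < length rl \<and> (\<exists>r\<in>set rl. fst r = q \<and> fst (snd r) = rs)"
        proof (cases b)
          case True
          with y xrs 2 show ?thesis by (force simp: scan_trans_True split: if_splits)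
        next
          case False
          with y xrs 2 show ?thesis by (force simp: scan_trans_False split: if_splits)
        qed
        then show ?thesis using 2 xrs by force
      qed
    qed
  qed auto
  moreover have "length rs = ?k \<and> length as = ?k \<and> x \<noteq> scan_state (accept_state M) 0"
    if eq: "?\<delta> b (x, rs) = Some (x', as)" for b x rs x' as
  proof (cases x rule: state_cases)
    case 1
    with eq k show ?thesis by (auto simp: scan_trans_start split: if_splits)
  next
    case (2 q j)
    show ?thesis
    proof (cases b)
      case True
      with eq 2 rule show ?thesis by (auto simp: scan_trans_True split: if_splits)
    next
      case False
      with eq 2 have "j < length rl" "rl ! j = (q, rs, fst (snd (snd (rl ! j))), as)"
        by (auto simp: scan_trans_False prod_eq_iff split: if_splits)
      then have "(q, rs, fst (snd (snd (rl ! j))), as) \<in> set rl" by (metis nth_mem)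
      with rule 2 show ?thesis by simp
    qed
  qed
  moreover have "x0 \<noteq> x1" if "?\<delta> False y = Some (x0, as0)" "?\<delta> True y = Some (x1, as1)" for y x0 as0 x1 as1
  proof -
    obtain x rs where xrs: "y = (x, rs)" by (cases y)
    show ?thesis
    proof (cases x rule: state_cases)
      case 1
      with that xrs show ?thesis by (simp add: scan_trans_start)
    next
      case (2 q j)
      with that xrs show ?thesis by (auto simp: scan_trans_False scan_trans_True split: if_splits)
    qed
  qed
  ultimately show ?thesis unfolding normal_form_def using k by simp
qed

text \<open>A step of \<open>M\<close> becomes a scan of at most \<open>length rl\<close> choices;
  the factor \<open>length rl + 2\<close> pays for it.\<close>

lemma scan_witnesses:
  assumes wf: "wf_machine M" and free: "oracle_free M"
    and rl: "set rl = rules M" "distinct rl"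
    and "runs M {} c n m" "length (snd c) = num_tapes M"
  defines "\<delta> \<equiv> scan_trans (num_tapes M) (start_state M) rl" and "a \<equiv> scan_state (accept_state M) 0"
  shows "halts \<delta> (scan_state (fst c) 0, snd c) ((length rl + 2) * n + 1) \<and>
    card (witnesses \<delta> a (Some (scan_state (fst c) 0, snd c))) = m"
  using assms(5,6)
proof (induction rule: runs.induct)
  case (accepting c n)
  have nf: "normal_form (num_tapes M) \<delta> 0 a"
    unfolding \<delta>_def a_def by (rule normal_form_scan_trans[OF wf rl(1)])
  have none: "nxt \<delta> b (scan_state (fst c) 0, snd c) = None" for b
  proof (rule ccontr)
    assume "nxt \<delta> b (scan_state (fst c) 0, snd c) \<noteq> None"
    then obtain x' as where "\<delta> b (a, map read_tape (snd c)) = Some (x', as)"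
      using accepting unfolding nxt_def a_def by (cases "\<delta> b (a, map read_tape (snd c))") (auto simp: a_def)
    then show False using nf unfolding normal_form_def by blast
  qed
  show ?case
  proof
    show "halts \<delta> (scan_state (fst c) 0, snd c) ((length rl + 2) * n + 1)"
      using none by (auto intro: halts.intros)
    show "card (witnesses \<delta> a (Some (scan_state (fst c) 0, snd c))) = Suc 0"
      using none accepting by (subst witnesses_Some) (simp add: a_def)
  qed
next
  case (branching c n \<kappa>)
  obtain q ts where c: "c = (q, ts)" by (cases c)
  let ?R = "length rl"
  let ?B = "(?R + 2) * n + 1"
  let ?res = "\<lambda>i. embed_step ts (snd (snd (rl ! i)))"
  let ?ok = "\<lambda>i. fst (rl ! i) = q \<and> fst (snd (rl ! i)) = map read_tape ts"
  let ?I = "\<lambda>j. {i. j \<le> i \<and> i < ?R \<and> ?ok i}"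
  have len: "length (snd (snd (snd (rl ! i)))) = num_tapes M" if "i < ?R" for i
  proof -
    have "rl ! i \<in> rules M" using that rl(1) nth_mem by blast
    then show ?thesis using wf by (auto simp: wf_machine_def)
  qed
  have succ: "{c'. step M {} c c'} = ?res ` ?I 0"
  proof -
    have "{(q', as). (q, map read_tape ts, q', as) \<in> rules M} = (\<lambda>i. snd (snd (rl ! i))) ` ?I 0"
    proof (intro set_eqI iffI)
      fix x assume "x \<in> {(q', as). (q, map read_tape ts, q', as) \<in> rules M}"
      then obtain i where "i < ?R" "rl ! i = (q, map read_tape ts, x)"
        unfolding rl(1)[symmetric] by (auto simp: in_set_conv_nth)
      then show "x \<in> (\<lambda>i. snd (snd (rl ! i))) ` ?I 0" by (intro image_eqI[of _ _ i]) simp_all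
    next
      fix x assume "x \<in> (\<lambda>i. snd (snd (rl ! i))) ` ?I 0"
      then obtain i where "i < ?R" "rl ! i = (q, map read_tape ts, x)"
        by (auto simp: prod_eq_iff)
      then have "(q, map read_tape ts, x) \<in> rules M" using rl(1) nth_mem by metis
      then show "x \<in> {(q', as). (q, map read_tape ts, q', as) \<in> rules M}" by (cases x) simp
    qed
    then show ?thesis
      using free unfolding c succs_oracle_free[OF free[unfolded oracle_free_def]] by (simp only: image_image)
  qed
  \<comment> \<open>Rules are tried by number, but \<open>runs\<close> sums over configurations. As
    \<open>rl\<close> is distinct and actions can be read off from their effect, both sums
    agree.\<close>
  have inj: "inj_on ?res (?I 0)"
  proof (rule inj_onI)
    fix i j assume i: "i \<in> ?I 0" and j: "j \<in> ?I 0" and eq: "?res i = ?res j"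
    then have "snd (snd (rl ! i)) = snd (snd (rl ! j))"
      using map2_act_inj[of "snd (snd (snd (rl ! i)))" ts "snd (snd (snd (rl ! j)))"] len branching.prems c
      by (auto simp: embed_step_def prod_eq_iff split: prod.splits)
    with i j have "rl ! i = rl ! j" by (auto simp: prod_eq_iff)
    with i j show "i = j" using rl(2) by (simp add: nth_eq_iff_index_eq)
  qed
  have IH: "halts \<delta> (scan_state (fst (?res i)) 0, snd (?res i)) ?B \<and>
      card (witnesses \<delta> a (Some (scan_state (fst (?res i)) 0, snd (?res i)))) = \<kappa> (?res i)"
    if "i \<in> ?I 0" for i
  proof -
    have "step M {} c (?res i)" using succ that by blast
    moreover from this have "length (snd (?res i)) = num_tapes M"
      by (rule length_step) (use wf branching.prems in auto)
    ultimately show ?thesis by (rule branching.IH)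
  qed
  \<comment> \<open>Induction on the number \<open>d\<close> of rules still to be tried, that is,
    backwards along the scan.\<close>
  have "halts \<delta> (scan_state q (?R - d), ts) (?B + d + 1) \<and>
      card (witnesses \<delta> a (Some (scan_state q (?R - d), ts))) = (\<Sum>i\<in>?I (?R - d). \<kappa> (?res i))"
    if "d \<le> ?R" for d
    using that
  proof (induction d)
    case 0
    have none: "nxt \<delta> b (scan_state q ?R, ts) = None" for b
      unfolding nxt_def \<delta>_def by (cases b) (simp_all add: scan_trans_True scan_trans_False)
    \<comment> \<open>Declining every rule ends in a dead end, not in acceptance, because only the
      state of \<open>M\<close> decides acceptance and \<open>q\<close> is not accepting.\<close>
    have "scan_state q ?R \<noteq> a" using branching(1) c by (simp add: a_def)
    then have "witnesses \<delta> a (Some (scan_state q ?R, ts)) = {}"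
      by (subst witnesses_Some) (simp add: none)
    moreover have "?I ?R = {}" by auto
    ultimately show ?case using none by (auto intro: halts.intros)
  next
    case (Suc d)
    let ?j = "?R - Suc d"
    have j: "Suc ?j = ?R - d" "?j < ?R" using Suc.prems by auto
    have f: "nxt \<delta> False (scan_state q ?j, ts) =
        (if ?ok ?j then Some (scan_state (fst (?res ?j)) 0, snd (?res ?j)) else None)"
      unfolding nxt_def \<delta>_def using j by (simp add: scan_trans_False embed_step_def split: prod.splits)
    have t: "nxt \<delta> True (scan_state q ?j, ts) =
        (if ?I 0 \<noteq> {} then Some (scan_state q (?R - d), ts) else None)"
    proof -
      have "(\<exists>q' as. (q, map read_tape ts, q', as) \<in> set rl) \<longleftrightarrow> ?I 0 \<noteq> {}"
      proof
        assume "\<exists>q' as. (q, map read_tape ts, q', as) \<in> set rl"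
        then obtain q' as i where "i < ?R" "rl ! i = (q, map read_tape ts, q', as)"
          unfolding in_set_conv_nth by blast
        then have "i \<in> ?I 0" by simp
        then show "?I 0 \<noteq> {}" by blast
      next
        assume "?I 0 \<noteq> {}"
        then obtain i where "i < ?R" "?ok i" by blast
        then have "(q, map read_tape ts, fst (snd (snd (rl ! i))), snd (snd (snd (rl ! i)))) \<in> set rl"
          using nth_mem[of i rl] by (metis prod.collapse)
        then show "\<exists>q' as. (q, map read_tape ts, q', as) \<in> set rl" by blast
      qed
      moreover have "nxt \<delta> True (scan_state q ?j, ts) =
          (if \<exists>q' as. (q, map read_tape ts, q', as) \<in> set rl then Some (scan_state q (?R - d), ts) else None)"
        unfolding nxt_def \<delta>_def using j by (simp add: scan_trans_True embed_step_def)
      ultimately show ?thesis by (simp only:)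
    qed
    note IHd = Suc.IH[OF Suc_leD[OF Suc.prems]]
    have okI: "?j \<in> ?I 0" if "?ok ?j" using that j by simp
    have "halts \<delta> (scan_state q ?j, ts) (Suc (?B + d + 1))"
    proof (rule halts.intros)
      fix b c' assume c': "nxt \<delta> b (scan_state q ?j, ts) = Some c'"
      show "halts \<delta> c' (?B + d + 1)"
      proof (cases b)
        case True
        with c' t IHd show ?thesis by (simp split: if_splits)
      next
        case False
        with c' f have "?ok ?j" "c' = (scan_state (fst (?res ?j)) 0, snd (?res ?j))"
          by (simp_all split: if_splits)
        with IH[OF okI] have "halts \<delta> c' ?B" by simp
        then show ?thesis by (rule halts_mono) simp
      qed
    qed
    moreover have "card (witnesses \<delta> a (Some (scan_state q ?j, ts))) = (\<Sum>i\<in>?I ?j. \<kappa> (?res i))"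
    proof -
      have fin: "finite (witnesses \<delta> a (nxt \<delta> False (scan_state q ?j, ts)))"
        "finite (witnesses \<delta> a (nxt \<delta> True (scan_state q ?j, ts)))"
        using f t IHd IH okI by (auto intro: finite_witnesses)
      have cf: "card (witnesses \<delta> a (nxt \<delta> False (scan_state q ?j, ts))) = (if ?ok ?j then \<kappa> (?res ?j) else 0)"
        using f IH okI by auto
      have ct: "card (witnesses \<delta> a (nxt \<delta> True (scan_state q ?j, ts))) = (\<Sum>i\<in>?I (?R - d). \<kappa> (?res i))"
      proof (cases "?I 0 = {}")
        case True
        then have "?I (?R - d) = {}" by blast
        then show ?thesis unfolding t using True by (simp only: simp_thms if_False witnesses_None card.empty sum.empty)
      next
        case False
        then show ?thesis unfolding t using IHd by simp
      qed
      have "?I ?j = (if ?ok ?j then insert ?j (?I (?R - d)) else ?I (?R - d))"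
        unfolding j(1)[symmetric] using j(2) by (auto simp: Suc_le_eq order_le_less)
      moreover have "?j \<notin> ?I (?R - d)" unfolding j(1)[symmetric] by simp
      moreover have "finite (?I (?R - d))" by simp
      ultimately have "(\<Sum>i\<in>?I ?j. \<kappa> (?res i)) = (if ?ok ?j then \<kappa> (?res ?j) else 0) + (\<Sum>i\<in>?I (?R - d). \<kappa> (?res i))"
        using sum.insert[of "?I (?R - d)" ?j "\<lambda>i. \<kappa> (?res i)"] by presburger
      moreover have "fst (scan_state q ?j, ts) \<noteq> a" using branching(1) c by (simp add: a_def)
      ultimately show ?thesis using card_witnesses[OF _ fin] cf ct by simp
    qed
    ultimately show ?case by simp
  qed
  from this[of ?R] have *: "halts \<delta> (scan_state q 0, ts) (?B + ?R + 1)"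
      "card (witnesses \<delta> a (Some (scan_state q 0, ts))) = (\<Sum>i\<in>?I 0. \<kappa> (?res i))" by auto
  have "(\<Sum>i\<in>?I 0. \<kappa> (?res i)) = (\<Sum>c' | step M {} c c'. \<kappa> c')"
    unfolding succ sum.reindex[OF inj] by simp
  moreover have "halts \<delta> (scan_state q 0, ts) ((?R + 2) * Suc n + 1)"
    using *(1) by (rule halts_mono) simp
  ultimately show ?case using * c by simp
qed

lemma read_start_tapes:
  "k \<ge> 1 \<Longrightarrow> map read_tape (start_tapes k w) = (if w = [] then 0 else bit_symbol (hd w)) # replicate (k - 1) 0"
  by (auto simp: start_tapes_def input_tape_eq read_tape_of map_replicate hd_conv_nth)

theorem sharpP_normal_form:
  assumes "f \<in> sharpP"
  shows "\<exists>k \<delta> s a. normal_form k \<delta> s a \<and> (\<exists>p :: nat poly. \<forall>w.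
    halts \<delta> (s, start_tapes k w) (poly p (length w)) \<and>
    card (witnesses \<delta> a (Some (s, start_tapes k w))) = f w)"
proof -
  obtain M and p :: "nat poly" where M: "wf_machine M" "oracle_free M"
    and runs: "\<forall>w. runs M {} (initial_config M w) (poly p (length w)) (f w)"
    using iffD1[OF sharpP_iff assms] by blast
  obtain rl where rl: "set rl = rules M" "distinct rl"
    using M(1) finite_distinct_list[of "rules M"] by (auto simp: wf_machine_def)
  define k where "k = num_tapes M"
  define \<delta> where "\<delta> = scan_trans k (start_state M) rl"
  define a where "a = scan_state (accept_state M) 0"
  have k: "k \<ge> 1" using M(1) by (simp add: wf_machine_def k_def)
  \<comment> \<open>The summand 2 is the 1 in the bound of \<open>scan_witnesses\<close> plus the
    additional initial step.\<close>
  define p' where "p' = smult (length rl + 2) p + 2"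
  have "halts \<delta> (0, start_tapes k w) (poly p' (length w)) \<and>
      card (witnesses \<delta> a (Some (0, start_tapes k w))) = f w" for w
  proof -
    let ?c = "(scan_state (start_state M) 0, start_tapes k w)"
    have init: "initial_config M w = (start_state M, start_tapes k w)"
      by (simp add: initial_config_def start_tapes_def k_def)
    have "length (snd (initial_config M w)) = num_tapes M"
      unfolding init using k by (simp add: start_tapes_def flip: k_def)
    from scan_witnesses[OF M rl runs[rule_format] this]
    have *: "halts \<delta> ?c ((length rl + 2) * poly p (length w) + 1)"
      "card (witnesses \<delta> a (Some ?c)) = f w"
      by (simp_all add: \<delta>_def a_def k_def init)
    have "map read_tape (start_tapes k w) \<in> (\<lambda>r. r # replicate (k - 1) 0) ` {..2}"
      unfolding read_start_tapes[OF k] by (intro imageI) (simp add: bit_symbol_def)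
    then have f: "nxt \<delta> False (0, start_tapes k w) = Some ?c"
      unfolding nxt_def \<delta>_def fst_conv snd_conv scan_trans_start
      by (simp add: embed_step_def)
    have t: "nxt \<delta> True (0, start_tapes k w) = None"
      unfolding nxt_def \<delta>_def by (simp add: scan_trans_start)
    have "halts \<delta> (0, start_tapes k w) (Suc ((length rl + 2) * poly p (length w) + 1))"
    proof (rule halts.intros)
      fix b c' assume "nxt \<delta> b (0, start_tapes k w) = Some c'"
      then show "halts \<delta> c' ((length rl + 2) * poly p (length w) + 1)" using f t *(1) by (cases b) auto
    qed
    moreover have "card (witnesses \<delta> a (Some (0, start_tapes k w))) = f w"
      using f t * by (subst card_witnesses) (auto simp: a_def intro: finite_witnesses)
    ultimately show ?thesis by (simp add: p'_def)
  qed
  moreover have "normal_form k \<delta> 0 a"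
    unfolding k_def \<delta>_def a_def by (rule normal_form_scan_trans[OF M(1) rl(1)])
  ultimately show ?thesis by blast
qed

section \<open>Ranks of witnesses\<close>

definition rules_at :: "machine \<Rightarrow> nat \<Rightarrow> nat list \<Rightarrow> (nat \<times> (nat \<times> dir) list) set" where
  "rules_at M q rs = {(q', as). (q, rs, q', as) \<in> rules M}"

lemma succs_rules_at:
  "oracle_states M = None \<Longrightarrow>
     {c'. step M A (q, ts) c'} = embed_step ts ` rules_at M q (map read_tape ts)"
  unfolding rules_at_def by (rule succs_oracle_free)

text \<open>The binary form of \<open>branching\<close>. Absent choices count 0, and disjointness
  prevents two choices from merging into one configuration.\<close>

lemma runs_union:
  assumes "fst c \<noteq> accept_state M" "{c'. step M A c c'} = set_option x \<union> set_option y"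
    "set_option x \<inter> set_option y = {}"
    "\<And>d. x = Some d \<Longrightarrow> runs M A d n k" "x = None \<Longrightarrow> k = 0"
    "\<And>d. y = Some d \<Longrightarrow> runs M A d n l" "y = None \<Longrightarrow> l = 0"
  shows "runs M A c (Suc n) (k + l)"
proof (cases x)
  case None
  show ?thesis
  proof (cases y)
    case None
    with \<open>x = None\<close> assms(2,5,7) show ?thesis using runs_dead[OF assms(1)] by simp
  next
    case (Some e)
    with None assms show ?thesis using runs_one[OF assms(1), of A e] by simp
  qed
next
  case (Some d)
  show ?thesis
  proof (cases y)
    case None
    with Some assms show ?thesis using runs_one[OF assms(1), of A d] by simp
  next
    case (Some e)
    have "{c'. step M A c c'} = {d, e}" "d \<noteq> e"
      using assms(2,3) \<open>x = Some d\<close> Some by auto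
    from runs_two[OF assms(1) this assms(4)[OF \<open>x = Some d\<close>] assms(6)[OF Some]] show ?thesis .
  qed
qed

definition phase :: "nat \<Rightarrow> nat \<Rightarrow> nat" where
  "phase i q = prod_encode (i, q)"

lemma phase_eq [simp]: "phase i q = phase j r \<longleftrightarrow> i = j \<and> q = r"
  by (simp add: phase_def)

abbreviation blanks :: "nat \<Rightarrow> tape list" where
  "blanks m \<equiv> replicate m blank_tape"

lemma map_read_blanks [simp]: "map read_tape (blanks m) = replicate m 0"
  by (simp add: map_replicate)

lemma map2_act_blanks:
  "map read_tape ts = replicate m 0 \<Longrightarrow> map2 act (keep (replicate m 0)) ts = ts"
  by (metis map2_act_keep)

lemma map2_act_blanks' [simp]: "map2 act (keep (replicate m 0)) (blanks m) = blanks m"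
  by (rule map2_act_blanks) simp

definition tape_symbols :: "nat set" where
  "tape_symbols = insert 0 (range bit_symbol)"

lemma finite_tape_symbols [simp]: "finite tape_symbols"
  by (simp add: tape_symbols_def)

lemma read_tape_symbols: "read_tape (tape_of w h) \<in> tape_symbols"
  by (simp add: tape_symbols_def read_tape_of)

lemma tape_symbols_simps [simp]: "0 \<in> tape_symbols" "bit_symbol b \<in> tape_symbols"
  by (simp_all add: tape_symbols_def)

lemma finite_trans_image:
  assumes "normal_form k \<delta> s a"
  shows "finite {g q rs q' as |q rs q' as. \<delta> b (q, rs) = Some (q', as)}"
proof (rule finite_subset)
  show "{g q rs q' as |q rs q' as. \<delta> b (q, rs) = Some (q', as)} \<subseteq>
      (\<lambda>(q, rs). g q rs (fst (the (\<delta> b (q, rs)))) (snd (the (\<delta> b (q, rs))))) ` dom (\<delta> b)"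
    by force
  show "finite ((\<lambda>(q, rs). g q rs (fst (the (\<delta> b (q, rs)))) (snd (the (\<delta> b (q, rs))))) ` dom (\<delta> b))"
    using assms by (simp add: normal_form_def)
qed

lemma normal_form_rule:
  "normal_form k \<delta> s a \<Longrightarrow> \<delta> b (q, rs) = Some (q', as) \<Longrightarrow> length rs = k \<and> length as = k \<and> q \<noteq> a"
  unfolding normal_form_def by metis

lemma normal_form_states:
  "normal_form k \<delta> s a \<Longrightarrow> \<delta> False x = Some (q, as) \<Longrightarrow> \<delta> True x = Some (q', as') \<Longrightarrow> q \<noteq> q'"
  unfolding normal_form_def by metis

lemma normal_form_None: "normal_form k \<delta> s a \<Longrightarrow> fst c = a \<Longrightarrow> nxt \<delta> b c = None"
  unfolding nxt_def
  by (cases "\<delta> b (fst c, map read_tape (snd c))") (auto dest: normal_form_rule)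

lemma normal_form_length:
  "normal_form k \<delta> s a \<Longrightarrow> nxt \<delta> b c = Some c' \<Longrightarrow> length (snd c) = k \<Longrightarrow> length (snd c') = k"
  unfolding nxt_def by (auto simp: embed_step_def dest: normal_form_rule)

lemma normal_form_distinct:
  "normal_form k \<delta> s a \<Longrightarrow> nxt \<delta> False c = Some d \<Longrightarrow> nxt \<delta> True c = Some e \<Longrightarrow> fst d \<noteq> fst e"
  unfolding nxt_def by (auto simp: embed_step_def dest: normal_form_states)

lemma tape_of_read_nth [simp]: "read_tape (tape_of (u @ b # v) (int (length u))) = bit_symbol b"
  by (simp add: read_tape_of)

lemma tape_of_read_end [simp]: "read_tape (tape_of u (int (length u))) = 0"
  by (simp add: read_tape_of)

lemma tape_of_read_before [simp]: "h < 0 \<Longrightarrow> read_tape (tape_of u h) = 0"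
  by (simp add: read_tape_of)

lemma act_tape_of:
  "act (bit_symbol b, d) (tape_of (u @ b # v) (int (length u))) = tape_of (u @ b # v) (int (length u) + shift d)"
  "act (0, d) (tape_of u (int (length u))) = tape_of u (int (length u) + shift d)"
  "h < 0 \<Longrightarrow> act (0, d) (tape_of u h) = tape_of u (h + shift d)"
  by (intro act_keep; simp)+

text \<open>Only the first word is made self-delimiting. The second stays in clear at the end, so a
  machine can extend the code letter by letter while it makes its choices.\<close>

fun encode :: "word \<Rightarrow> word \<Rightarrow> word" where
  "encode [] u = False # u"
| "encode (x # w) u = True # x # encode w u"

fun decode :: "word \<Rightarrow> (word \<times> word) option" where
  "decode [] = None"
| "decode (False # u) = Some ([], u)"
| "decode [True] = None"
| "decode (True # x # v) = map_option (\<lambda>(w, u). (x # w, u)) (decode v)"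

lemma decode_encode [simp]: "decode (encode w u) = Some (w, u)"
  by (induction w) auto

lemma length_encode: "length (encode w u) = 2 * length w + 1 + length u"
  by (induction w) auto

text \<open>The number of witnesses that branch off to the left of the given word. In a normal form
  no witness is a proper prefix of another, so for a witness this is its lexicographic position,
  starting from 0. On other words it is merely what the rank machine happens to count.\<close>

fun rank :: "trans \<Rightarrow> nat \<Rightarrow> config \<Rightarrow> word \<Rightarrow> nat" where
  "rank \<delta> a c [] = 0"
| "rank \<delta> a c (b # u) = (if b then card (witnesses \<delta> a (nxt \<delta> False c)) else 0) +
     (case nxt \<delta> b c of None \<Rightarrow> 0 | Some c' \<Rightarrow> rank \<delta> a c' u)"

text \<open>
  On \<open>encode w u\<close>, the machine writes \<open>w\<close> on its second tape (phases 0 and 1), rewinds it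
  (phase 2) and runs the normal form on it, first with the choices \<open>u\<close> (phase 3). Whenever \<open>u\<close>
  has the choice \<open>True\<close>, it may instead take the choice \<open>False\<close> and continue freely (phase 4). So
  its accepting paths are the witnesses that precede \<open>u\<close> lexicographically.
\<close>

definition rank_machine :: "nat \<Rightarrow> trans \<Rightarrow> nat \<Rightarrow> nat \<Rightarrow> machine" where
  "rank_machine k \<delta> s a = \<lparr>num_tapes = Suc k, start_state = phase 0 0, accept_state = phase 4 a,
     oracle_states = None, rules = (let Z = replicate (k - Suc 0) 0 in
       {(phase 0 0, bit_symbol True # 0 # Z, phase 1 0, (bit_symbol True, MoveRight) # (0, Stay) # keep Z),
        (phase 0 0, bit_symbol False # 0 # Z, phase 2 0, (bit_symbol False, MoveRight) # (0, MoveLeft) # keep Z)} \<union>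
       (\<lambda>b. (phase 1 0, bit_symbol b # 0 # Z,
          phase 0 0, (bit_symbol b, MoveRight) # (bit_symbol b, MoveRight) # keep Z)) ` UNIV \<union>
       (\<lambda>(x, b). (phase 2 0, x # bit_symbol b # Z,
          phase 2 0, (x, Stay) # (bit_symbol b, MoveLeft) # keep Z)) ` (tape_symbols \<times> UNIV) \<union>
       (\<lambda>x. (phase 2 0, x # 0 # Z, phase 3 s, (x, Stay) # (0, MoveRight) # keep Z)) ` tape_symbols \<union>
       (\<Union>b. {(phase 3 q, bit_symbol b # rs, phase 3 q', (bit_symbol b, MoveRight) # as) |q rs q' as.
          \<delta> b (q, rs) = Some (q', as)}) \<union>
       {(phase 3 q, bit_symbol True # rs, phase 4 q', (0, Stay) # as) |q rs q' as.
          \<delta> False (q, rs) = Some (q', as)} \<union>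
       (\<Union>b. {(phase 4 q, 0 # rs, phase 4 q', (0, Stay) # as) |q rs q' as.
          \<delta> b (q, rs) = Some (q', as)}))\<rparr>"

context
  fixes k :: nat and \<delta> :: trans and s a :: nat
  assumes nf: "normal_form k \<delta> s a"
begin

abbreviation "RM \<equiv> rank_machine k \<delta> s a"

lemma rank_machine_simps [simp]:
  "num_tapes RM = Suc k" "start_state RM = phase 0 0" "accept_state RM = phase 4 a"
  "oracle_states RM = None"
  by (simp_all add: rank_machine_def)

lemma wf_rank_machine: "wf_machine RM" "oracle_free RM"
proof -
  have k: "k \<ge> 1" and len: "\<And>b q rs q' as. \<delta> b (q, rs) = Some (q', as) \<Longrightarrow>
      length rs = k \<and> length as = k \<and> q \<noteq> a"
    using nf by (simp_all add: normal_form_def)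
  show "oracle_free RM" by (simp add: oracle_free_def)
  have "finite (rules RM)"
    unfolding rank_machine_def Let_def by (simp add: finite_trans_image[OF nf])
  moreover have "\<forall>(q, rs, q', as)\<in>rules RM. length rs = Suc k \<and> length as = Suc k \<and> q \<noteq> phase 4 a"
    unfolding rank_machine_def Let_def using k by (auto dest: len)
  ultimately show "wf_machine RM" unfolding wf_machine_def by simp
qed

text \<open>From here on the input tape is frozen. The deviating step has erased the cell under its
  head, so that only a blank has to be matched there.\<close>

lemma rank_phase4:
  assumes "halts \<delta> c n" "length (snd c) = k" "read_tape t = 0"
  shows "runs RM {} (phase 4 (fst c), t # snd c) n (card (witnesses \<delta> a (Some c)))"
  using assms(1,2)
proof (induction rule: halts.induct)
  case (1 c n)
  show ?case
  proof (cases "fst c = a")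
    case True
    then have "witnesses \<delta> a (Some c) = {[]}"
      by (subst witnesses_Some) (simp add: normal_form_None[OF nf])
    then show ?thesis using True by (simp add: runs.accepting)
  next
    case False
    let ?g = "\<lambda>c. (phase 4 (fst c), t # snd c) :: config"
    have at: "rules_at RM (phase 4 q) (0 # rs) =
        (\<Union>b. (\<lambda>(q', as). (phase 4 q', (0, Stay) # as)) ` set_option (\<delta> b (q, rs)))" for q rs
      unfolding rules_at_def rank_machine_def Let_def by (auto simp: image_iff)
    have act: "act (0, Stay) t = t" using act_stay[of t] assms(3) by simp
    have "{c'. step RM {} (phase 4 (fst c), t # snd c) c'} = (\<Union>b. ?g ` set_option (nxt \<delta> b c))"
      by (simp add: succs_rules_at at assms(3) nxt_def image_UN image_image option.set_map
          embed_step_def case_prod_unfold act)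
    also have "\<dots> = set_option (map_option ?g (nxt \<delta> False c)) \<union> set_option (map_option ?g (nxt \<delta> True c))"
      by (simp add: UNIV_bool option.set_map Un_commute)
    finally have succ: "{c'. step RM {} (phase 4 (fst c), t # snd c) c'} = \<dots>" .
    have fin: "finite (witnesses \<delta> a (nxt \<delta> b c))" for b
      by (cases "nxt \<delta> b c") (auto intro: finite_witnesses 1(1))
    show ?thesis
      unfolding card_witnesses[OF False fin fin]
    proof (rule runs_union[OF _ succ])
      show "set_option (map_option ?g (nxt \<delta> False c)) \<inter> set_option (map_option ?g (nxt \<delta> True c)) = {}"
        using normal_form_distinct[OF nf, of c] by (auto simp: option.set_map elim!: option.set_cases)
    qed (use False 1 normal_form_length[OF nf] in auto)
  qed
qed

text \<open>Following the given choices to their end is a dead end, hence the count 0 for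
  \<open>[]\<close>: all accepting paths come from deviations. The phase numbers keep a deviation
  apart from the continuation.\<close>

lemma rank_phase3:
  assumes "halts \<delta> c n" "length (snd c) = k"
  shows "runs RM {} (phase 3 (fst c), tape_of (u @ v) (int (length u)) # snd c) n (rank \<delta> a c v)"
  using assms
proof (induction v arbitrary: c n u)
  case Nil
  then obtain m where n: "n = Suc m" by (cases rule: halts.cases) auto
  have "rules_at RM (phase 3 q) (0 # rs) = {}" for q rs
    unfolding rules_at_def rank_machine_def Let_def by auto
  then show ?case unfolding n by (simp add: succs_rules_at runs_dead)
next
  case (Cons b v)
  from Cons.prems(1) obtain m where n: "n = Suc m" and
    m: "\<And>b c'. nxt \<delta> b c = Some c' \<Longrightarrow> halts \<delta> c' m"
    by (cases rule: halts.cases) auto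
  let ?t = "tape_of (u @ b # v) (int (length u))"
  let ?x = "if b then map_option (\<lambda>c. (phase 4 (fst c), act (0, Stay) ?t # snd c)) (nxt \<delta> False c) else None"
  let ?y = "map_option (\<lambda>c. (phase 3 (fst c), act (bit_symbol b, MoveRight) ?t # snd c)) (nxt \<delta> b c)"
  have at: "rules_at RM (phase 3 q) (bit_symbol b # rs) =
      (if b then (\<lambda>(q', as). (phase 4 q', (0, Stay) # as)) ` set_option (\<delta> False (q, rs)) else {}) \<union>
      (\<lambda>(q', as). (phase 3 q', (bit_symbol b, MoveRight) # as)) ` set_option (\<delta> b (q, rs))" for q rs
    unfolding rules_at_def rank_machine_def Let_def by (auto simp: image_iff)
  have succ: "{c'. step RM {} (phase 3 (fst c), ?t # snd c) c'} = set_option ?x \<union> set_option ?y"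
    by (simp add: succs_rules_at at nxt_def image_Un image_image option.set_map
        embed_step_def case_prod_unfold)
  have r0: "read_tape (act (0, Stay) ?t) = 0" by (simp add: tape_of_def)
  have "runs RM {} (phase 3 (fst c), ?t # snd c) (Suc m)
    ((if b then card (witnesses \<delta> a (nxt \<delta> False c)) else 0) +
     (case nxt \<delta> b c of None \<Rightarrow> 0 | Some c' \<Rightarrow> rank \<delta> a c' v))"
  proof (rule runs_union[OF _ succ])
    show "set_option ?x \<inter> set_option ?y = {}"
      by (auto simp: option.set_map)
    show "runs RM {} d m (if b then card (witnesses \<delta> a (nxt \<delta> False c)) else 0)" if "?x = Some d" for d
    proof -
      from that obtain c' where c': "b" "nxt \<delta> False c = Some c'" "d = (phase 4 (fst c'), act (0, Stay) ?t # snd c')"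
        by (auto split: if_splits)
      show ?thesis
        using rank_phase4[OF m[OF c'(2)] normal_form_length[OF nf c'(2) Cons.prems(2)] r0] c' by simp
    qed
    show "runs RM {} d m (case nxt \<delta> b c of None \<Rightarrow> 0 | Some c' \<Rightarrow> rank \<delta> a c' v)" if "?y = Some d" for d
    proof -
      from that obtain c' where c': "nxt \<delta> b c = Some c'"
        "d = (phase 3 (fst c'), act (bit_symbol b, MoveRight) ?t # snd c')" by auto
      have "act (bit_symbol b, MoveRight) ?t = tape_of ((u @ [b]) @ v) (int (length (u @ [b])))"
        by (simp add: act_tape_of add.commute)
      with c' show ?thesis
        using Cons.IH[OF m[OF c'(1)] normal_form_length[OF nf c'(1) Cons.prems(2)], of "u @ [b]"] by simp
    qed
  qed (auto split: if_splits)
  then show ?case unfolding n by simp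
qed

text \<open>\<open>h\<close> is the number of letters at or left of the head, which is therefore in
  cell \<open>h - 1\<close>; for \<open>h = 0\<close> it is on the blank before the word, where the
  machine turns round.\<close>

lemma rank_phase2:
  assumes "runs RM {} (phase 3 s, tape_of v i # tape_of w 0 # blanks (k - Suc 0)) n m" "h \<le> length w"
  shows "runs RM {} (phase 2 0, tape_of v i # tape_of w (int h - 1) # blanks (k - Suc 0)) (n + h + 1) m"
  using assms(2)
proof (induction h)
  case 0
  let ?x = "read_tape (tape_of v i)"
  have "rules_at RM (phase 2 0) (x # 0 # replicate (k - Suc 0) 0) =
      {(phase 3 s, (x, Stay) # (0, MoveRight) # keep (replicate (k - Suc 0) 0))}" if "x \<in> tape_symbols" for x
    unfolding rules_at_def rank_machine_def Let_def using that by auto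
  then have "{c'. step RM {} (phase 2 0, tape_of v i # tape_of w (int 0 - 1) # blanks (k - Suc 0)) c'} =
      {(phase 3 s, tape_of v i # tape_of w 0 # blanks (k - Suc 0))}"
    by (simp add: succs_rules_at read_tape_symbols embed_step_def act_stay act_tape_of)
  from runs_one[OF _ this assms(1)] show ?case by simp
next
  case (Suc h)
  then obtain w1 b w2 where w: "w = w1 @ b # w2" "length w1 = h"
    by (metis Suc_le_lessD id_take_nth_drop length_take min.absorb4)
  have "rules_at RM (phase 2 0) (x # bit_symbol b # replicate (k - Suc 0) 0) =
      {(phase 2 0, (x, Stay) # (bit_symbol b, MoveLeft) # keep (replicate (k - Suc 0) 0))}"
    if "x \<in> tape_symbols" for x
    unfolding rules_at_def rank_machine_def Let_def using that by auto
  then have "{c'. step RM {} (phase 2 0, tape_of v i # tape_of w (int (Suc h) - 1) # blanks (k - Suc 0)) c'} =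
      {(phase 2 0, tape_of v i # tape_of w (int h - 1) # blanks (k - Suc 0))}"
    unfolding w(1) w(2)[symmetric]
    by (simp add: succs_rules_at read_tape_symbols embed_step_def act_stay act_tape_of)
  from runs_one[OF _ this Suc.IH] Suc.prems show ?case by simp
qed

text \<open>The default 0 is what the machine counts on a malformed input, where it gets
  stuck.\<close>

definition decoded_rank :: "word \<Rightarrow> nat" where
  "decoded_rank v = (case decode v of None \<Rightarrow> 0 | Some (w, u) \<Rightarrow> rank \<delta> a (s, start_tapes k w) u)"

text \<open>The decoded word is known only at the end, hence one time bound \<open>N\<close> for all
  words that can still arise.\<close>

lemma rank_phase0:
  assumes "\<And>w'. length w' \<le> length w + length v \<Longrightarrow> halts \<delta> (s, start_tapes k w') N"
  shows "runs RM {} (phase 0 0, tape_of (u @ v) (int (length u)) # tape_of w (int (length w)) # blanks (k - Suc 0))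
    (N + length w + 2 * length v + 3)
    (case decode v of None \<Rightarrow> 0 | Some (w', u') \<Rightarrow> rank \<delta> a (s, start_tapes k (w @ w')) u')"
  using assms
proof (induction v arbitrary: u w rule: decode.induct)
  case 1
  have "rules_at RM (phase 0 0) (0 # rs) = {}" for rs
    unfolding rules_at_def rank_machine_def Let_def by auto
  then show ?case by (simp add: succs_rules_at runs_dead numeral_3_eq_3)
next
  case (2 v)
  have k: "k \<ge> 1" using nf by (simp add: normal_form_def)
  have at: "rules_at RM (phase 0 0) (bit_symbol False # 0 # replicate (k - Suc 0) 0) =
      {(phase 2 0, (bit_symbol False, MoveRight) # (0, MoveLeft) # keep (replicate (k - Suc 0) 0))}"
    unfolding rules_at_def rank_machine_def Let_def by auto
  have "{c'. step RM {} (phase 0 0, tape_of (u @ False # v) (int (length u)) # tape_of w (int (length w)) # blanks (k - Suc 0)) c'} =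
      {(phase 2 0, tape_of ((u @ [False]) @ v) (int (length (u @ [False]))) # tape_of w (int (length w) - 1) # blanks (k - Suc 0))}"
    by (simp add: succs_rules_at at embed_step_def act_tape_of add.commute)
  note one = runs_one[OF _ this]
  have "halts \<delta> (s, start_tapes k w) N" using 2 by simp
  from rank_phase3[OF this, of "u @ [False]" v] k
  have "runs RM {} (phase 3 s, tape_of ((u @ [False]) @ v) (int (length (u @ [False]))) # tape_of w 0 # blanks (k - Suc 0))
      N (rank \<delta> a (s, start_tapes k w) v)"
    by (simp add: start_tapes_def input_tape_eq)
  from one[OF _ rank_phase2[OF this order_refl]]
  have "runs RM {} (phase 0 0, tape_of (u @ False # v) (int (length u)) # tape_of w (int (length w)) # blanks (k - Suc 0))
      (N + length w + 2) (rank \<delta> a (s, start_tapes k w) v)" by simp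
  then show ?case by (simp del: append_assoc) (rule runs_mono, assumption, simp)
next
  case 3
  have "rules_at RM (phase 0 0) (bit_symbol True # 0 # replicate (k - Suc 0) 0) =
      {(phase 1 0, (bit_symbol True, MoveRight) # (0, Stay) # keep (replicate (k - Suc 0) 0))}"
    unfolding rules_at_def rank_machine_def Let_def by auto
  then have succ: "{c'. step RM {} (phase 0 0, tape_of (u @ [True]) (int (length u)) # tape_of w (int (length w)) # blanks (k - Suc 0)) c'} =
      {(phase 1 0, tape_of (u @ [True]) (int (length (u @ [True]))) # tape_of w (int (length w)) # blanks (k - Suc 0))}"
    by (simp add: succs_rules_at embed_step_def act_tape_of add.commute)
  have "rules_at RM (phase 1 0) (0 # rs) = {}" for rs
    unfolding rules_at_def rank_machine_def Let_def by auto
  then have dead: "{c'. step RM {} (phase 1 0, tape_of (u @ [True]) (int (length (u @ [True]))) # tape_of w (int (length w)) # blanks (k - Suc 0)) c'} = {}"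
    unfolding succs_rules_at[OF rank_machine_simps(4)] list.map tape_of_read_end by simp
  have "runs RM {} (phase 0 0, tape_of (u @ [True]) (int (length u)) # tape_of w (int (length w)) # blanks (k - Suc 0)) (Suc (Suc 0)) 0"
    by (rule runs_one[OF _ succ]) (use dead in \<open>simp_all add: runs_dead\<close>)
  then have "runs RM {} (phase 0 0, tape_of (u @ [True]) (int (length u)) # tape_of w (int (length w)) # blanks (k - Suc 0)) (N + length w + 2 * length [True] + 3) 0"
    by (rule runs_mono) simp
  then show ?case by simp
next
  case (4 x v)
  have "rules_at RM (phase 0 0) (bit_symbol True # 0 # replicate (k - Suc 0) 0) =
      {(phase 1 0, (bit_symbol True, MoveRight) # (0, Stay) # keep (replicate (k - Suc 0) 0))}"
    unfolding rules_at_def rank_machine_def Let_def by auto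
  then have succ0: "{c'. step RM {} (phase 0 0, tape_of (u @ True # x # v) (int (length u)) # tape_of w (int (length w)) # blanks (k - Suc 0)) c'} =
      {(phase 1 0, tape_of ((u @ [True]) @ x # v) (int (length (u @ [True]))) # tape_of w (int (length w)) # blanks (k - Suc 0))}"
    by (simp add: succs_rules_at embed_step_def act_tape_of add.commute)
  have at1: "rules_at RM (phase 1 0) (bit_symbol x # 0 # replicate (k - Suc 0) 0) =
      {(phase 0 0, (bit_symbol x, MoveRight) # (bit_symbol x, MoveRight) # keep (replicate (k - Suc 0) 0))}"
    unfolding rules_at_def rank_machine_def Let_def by auto
  have succ1: "{c'. step RM {} (phase 1 0, tape_of ((u @ [True]) @ x # v) (int (length (u @ [True]))) # tape_of w (int (length w)) # blanks (k - Suc 0)) c'} =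
      {(phase 0 0, tape_of ((u @ [True, x]) @ v) (int (length (u @ [True, x]))) # tape_of (w @ [x]) (int (length (w @ [x]))) # blanks (k - Suc 0))}"
    unfolding succs_rules_at[OF rank_machine_simps(4)] list.map tape_of_read_nth tape_of_read_end map_read_blanks at1
    by (simp add: embed_step_def act_tape_of(1) act_append add.commute act_tape_of(1)[of _ _ "u @ [True]", simplified])
  have "runs RM {} (phase 0 0, tape_of ((u @ [True, x]) @ v) (int (length (u @ [True, x]))) # tape_of (w @ [x]) (int (length (w @ [x]))) # blanks (k - Suc 0))
      (N + length (w @ [x]) + 2 * length v + 3)
    (case decode v of None \<Rightarrow> 0 | Some (w', u') \<Rightarrow> rank \<delta> a (s, start_tapes k ((w @ [x]) @ w')) u')"
    by (rule "4.IH") (use "4.prems" in simp)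
  from runs_one[OF _ succ0 runs_one[OF _ succ1 this]]
  have "runs RM {} (phase 0 0, tape_of (u @ True # x # v) (int (length u)) # tape_of w (int (length w)) # blanks (k - Suc 0))
      (Suc (Suc (N + length (w @ [x]) + 2 * length v + 3)))
    (case decode v of None \<Rightarrow> 0 | Some (w', u') \<Rightarrow> rank \<delta> a (s, start_tapes k ((w @ [x]) @ w')) u')"
    by simp
  moreover have time: "Suc (Suc (N + length (w @ [x]) + 2 * length v + 3)) \<le>
      N + length w + 2 * length (True # x # v) + 3"
    by simp
  moreover have "(case decode v of None \<Rightarrow> 0 | Some (w', u') \<Rightarrow> rank \<delta> a (s, start_tapes k ((w @ [x]) @ w')) u') =
    (case decode (True # x # v) of None \<Rightarrow> 0 | Some (w', u') \<Rightarrow> rank \<delta> a (s, start_tapes k (w @ w')) u')"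
    by (simp split: option.splits prod.splits)
  ultimately show ?case by (simp only: runs_mono)
qed

lemma decoded_rank_sharpP:
  fixes p :: "nat poly"
  assumes "\<And>w. halts \<delta> (s, start_tapes k w) (poly p (length w))"
  shows "decoded_rank \<in> sharpP"
proof -
  have k: "k \<ge> 1" using nf by (simp add: normal_form_def)
  have "runs RM {} (initial_config RM v) (poly (p + [:3, 2:]) (length v)) (decoded_rank v)" for v
  proof -
    have "halts \<delta> (s, start_tapes k w') (poly p (length v))" if "length w' \<le> length [] + length v" for w'
      by (rule halts_mono[OF assms poly_nat_mono]) (use that in simp)
    from rank_phase0[where w = "[]" and v = v and u = "[]", OF this, unfolded append_Nil]
    have "runs RM {} (phase 0 0, input_tape v # blank_tape # blanks (k - Suc 0)) (poly (p + [:3, 2:]) (length v)) (decoded_rank v)"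
      by (simp add: decoded_rank_def input_tape_eq blank_tape_eq algebra_simps)
    moreover have "initial_config RM v = (phase 0 0, input_tape v # blank_tape # blanks (k - Suc 0))"
    proof -
      have "blanks k = blank_tape # blanks (k - Suc 0)" using k by (cases k) simp_all
      then show ?thesis by (simp add: initial_config_def)
    qed
    ultimately show ?thesis by simp
  qed
  then show ?thesis unfolding sharpP_iff using wf_rank_machine by blast
qed

text \<open>The ranks hit each number below the number of witnesses exactly once. The offset
  \<open>m\<close> carries the induction: below the choice \<open>True\<close>, all ranks are
  shifted by the number of witnesses below \<open>False\<close>.\<close>

lemma sum_rank:
  fixes S :: "nat \<Rightarrow> nat"
  assumes "halts \<delta> c n"
  shows "(\<Sum>u\<in>witnesses \<delta> a (Some c). S (m + rank \<delta> a c u)) =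
    (\<Sum>r<card (witnesses \<delta> a (Some c)). S (m + r))"
  using assms
proof (induction arbitrary: m rule: halts.induct)
  case (1 c n)
  show ?case
  proof (cases "fst c = a")
    case True
    then have "witnesses \<delta> a (Some c) = {[]}"
      by (subst witnesses_Some) (simp add: normal_form_None[OF nf])
    then show ?thesis by simp
  next
    case False
    let ?W = "\<lambda>b. witnesses \<delta> a (nxt \<delta> b c)"
    have fin: "finite (?W b)" for b
      by (cases "nxt \<delta> b c") (auto intro: finite_witnesses 1(1))
    have part: "(\<Sum>u\<in>?W b. S (m + rank \<delta> a c (b # u))) =
        (\<Sum>r<card (?W b). S (m + (if b then card (?W False) else 0) + r))" for b
    proof (cases "nxt \<delta> b c")
      case (Some d)
      show ?thesis using 1(2)[OF Some, of "m + (if b then card (?W False) else 0)"] Some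
        by (simp add: add.assoc)
    qed simp
    have "(\<Sum>u\<in>witnesses \<delta> a (Some c). S (m + rank \<delta> a c u)) =
        (\<Sum>u\<in>(#) False ` ?W False \<union> (#) True ` ?W True. S (m + rank \<delta> a c u))"
      using False by (subst witnesses_Some) simp
    also have "\<dots> = (\<Sum>u\<in>?W False. S (m + rank \<delta> a c (False # u))) + (\<Sum>u\<in>?W True. S (m + rank \<delta> a c (True # u)))"
      by (subst sum.union_disjoint) (use fin in \<open>auto simp: sum.reindex simp del: rank.simps\<close>)
    also have "\<dots> = (\<Sum>r<card (?W False). S (m + r)) + (\<Sum>r<card (?W True). S (m + card (?W False) + r))"
      unfolding part by simp
    also have "\<dots> = (\<Sum>r<card (?W False) + card (?W True). S (m + r))"
    proof -
      have "(\<Sum>r<i + j. S (m + r)) = (\<Sum>r<i. S (m + r)) + (\<Sum>r<j. S (m + i + r))" for i j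
        by (induction j) (simp_all add: add.assoc)
      then show ?thesis by simp
    qed
    finally show ?thesis unfolding card_witnesses[OF False fin fin] .
  qed
qed

end

section \<open>Sums over witnesses\<close>

lemma encode_append: "encode w u = encode w [] @ u"
  by (induction w) auto

text \<open>
  The machine writes \<open>encode w []\<close> on the tape \<open>k\<close> (phases 0 and 1), rewinds its input tape
  (phase 2), runs the normal form while appending the choices to tape \<open>k\<close> (phase 3), rewinds
  tape \<open>k\<close> (phase 4) and runs \<open>X\<close> on it (phase 5). The step that accepts blanks the cells under
  the heads of the first \<open>k\<close> tapes, so that the rules of \<open>X\<close> need to consider only blanks there.
\<close>

definition log_step :: "nat \<Rightarrow> nat \<Rightarrow> nat \<Rightarrow> bool \<Rightarrow> nat \<Rightarrow> (nat \<times> dir) list \<Rightarrow> nat \<times> (nat \<times> dir) list" where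
  "log_step k kX a b q as = (if q = a
     then (phase 4 0, keep (replicate k 0) @ (bit_symbol b, Stay) # keep (replicate (kX - Suc 0) 0))
     else (phase 3 q, as @ (bit_symbol b, MoveRight) # keep (replicate (kX - Suc 0) 0)))"

definition log_machine :: "nat \<Rightarrow> trans \<Rightarrow> nat \<Rightarrow> nat \<Rightarrow> machine \<Rightarrow> machine" where
  "log_machine k \<delta> s a X = \<lparr>num_tapes = k + num_tapes X, start_state = phase 0 0,
     accept_state = phase 5 (accept_state X), oracle_states = None,
     rules = (let Z = replicate (k - Suc 0) 0; ZX = replicate (num_tapes X - Suc 0) 0; Z' = replicate k 0 in
       (\<lambda>b. (phase 0 0, bit_symbol b # Z @ 0 # ZX,
          phase 1 0, (bit_symbol b, Stay) # keep Z @ (bit_symbol True, MoveRight) # keep ZX)) ` UNIV \<union>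
       (\<lambda>b. (phase 1 0, bit_symbol b # Z @ 0 # ZX,
          phase 0 0, (bit_symbol b, MoveRight) # keep Z @ (bit_symbol b, MoveRight) # keep ZX)) ` UNIV \<union>
       {(phase 0 0, 0 # Z @ 0 # ZX,
          phase 2 0, (0, MoveLeft) # keep Z @ (bit_symbol False, MoveRight) # keep ZX)} \<union>
       (\<lambda>b. (phase 2 0, bit_symbol b # Z @ 0 # ZX,
          phase 2 0, (bit_symbol b, MoveLeft) # keep Z @ (0, Stay) # keep ZX)) ` UNIV \<union>
       {(phase 2 0, 0 # Z @ 0 # ZX, phase 3 s, (0, MoveRight) # keep Z @ (0, Stay) # keep ZX)} \<union>
       (\<Union>b. {(phase 3 q, rs @ 0 # ZX, log_step k (num_tapes X) a b q' as) |q rs q' as.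
          \<delta> b (q, rs) = Some (q', as)}) \<union>
       (\<lambda>b. (phase 4 0, Z' @ bit_symbol b # ZX,
          phase 4 0, keep Z' @ (bit_symbol b, MoveLeft) # keep ZX)) ` UNIV \<union>
       {(phase 4 0, Z' @ 0 # ZX, phase 5 (start_state X), keep Z' @ (0, MoveRight) # keep ZX)} \<union>
       (\<lambda>(q, rs, q', as). (phase 5 q, Z' @ rs, phase 5 q', keep Z' @ as)) ` rules X)\<rparr>"

context
  fixes k :: nat and \<delta> :: trans and s a :: nat and X :: machine
  assumes nf: "normal_form k \<delta> s a" and wfX: "wf_machine X" and freeX: "oracle_free X"
begin

abbreviation "LM \<equiv> log_machine k \<delta> s a X"
abbreviation "kX \<equiv> num_tapes X"

lemma log_machine_simps [simp]:
  "num_tapes LM = k + kX" "start_state LM = phase 0 0" "accept_state LM = phase 5 (accept_state X)"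
  "oracle_states LM = None"
  by (simp_all add: log_machine_def)

lemma wf_log_machine: "wf_machine LM" "oracle_free LM"
proof -
  have k: "k \<ge> 1" using nf by (simp add: normal_form_def)
  have X: "kX \<ge> 1" "finite (rules X)" and
    lenX: "\<And>q rs q' as. (q, rs, q', as) \<in> rules X \<Longrightarrow> length rs = kX \<and> length as = kX \<and> q \<noteq> accept_state X"
    using wfX by (auto simp: wf_machine_def)
  show "oracle_free LM" by (simp add: oracle_free_def)
  have "finite (rules LM)"
    unfolding log_machine_def Let_def using X by (simp add: finite_trans_image[OF nf])
  moreover have "\<forall>(q, rs, q', as)\<in>rules LM.
      length rs = k + kX \<and> length as = k + kX \<and> q \<noteq> phase 5 (accept_state X)"
    unfolding log_machine_def Let_def using k X(1) by (auto simp: log_step_def split: if_splits dest: lenX normal_form_rule[OF nf])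
  ultimately show "wf_machine LM" unfolding wf_machine_def using k by simp
qed

text \<open>The tapes \<open>ms\<close> may still hold the remains of the first computation, but
  their heads rest on blanks and no longer move, so they cannot interfere with
  \<open>X\<close>.\<close>

lemma log_phase5:
  assumes "runs X {} c n m" "length (snd c) = kX" "map read_tape ms = replicate k 0"
  shows "runs LM {} (phase 5 (fst c), ms @ snd c) n m"
proof -
  have len: "length ms = k" using arg_cong[OF assms(3), of length] by simp
  let ?E = "\<lambda>c :: config. (phase 5 (fst c), ms @ snd c)"
  have at: "rules_at LM (phase 5 q) (replicate k 0 @ rs) =
      (\<lambda>(q', as). (phase 5 q', keep (replicate k 0) @ as)) ` rules_at X q rs" for q rs
    unfolding rules_at_def log_machine_def Let_def by (auto simp: image_iff) force
  have step: "{c'. step LM {} (?E c) c'} = ?E ` {c'. step X {} c c'}" if "length (snd c) = kX" for c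
  proof -
    obtain q ts where c: "c = (q, ts)" by (cases c)
    show ?thesis
      unfolding c fst_conv snd_conv succs_rules_at[OF freeX[unfolded oracle_free_def]]
        succs_rules_at[OF log_machine_simps(4)] map_append assms(3) at image_image
      by (rule image_cong) (auto simp: embed_step_def len map2_act_blanks[OF assms(3)])
  qed
  have "runs LM {} (?E c) n m"
    by (rule runs_embed[where I = "\<lambda>c. length (snd c) = kX", OF assms(1,2) step])
      (auto simp: inj_on_def prod_eq_iff dest: length_step[OF _ wfX])
  then show ?thesis .
qed

lemma log_phase4:
  assumes "runs X {} (start_state X, start_tapes kX v) n m" "map read_tape ms = replicate k 0" "h \<le> length v"
  shows "runs LM {} (phase 4 0, ms @ tape_of v (int h - 1) # blanks (kX - Suc 0)) (n + h + 1) m"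
  using assms(3)
proof (induction h)
  have len: "length ms = k" using arg_cong[OF assms(2), of length] by simp
  case 0
  have X: "kX \<ge> 1" using wfX by (simp add: wf_machine_def)
  have at: "rules_at LM (phase 4 0) (replicate k 0 @ 0 # replicate (kX - Suc 0) 0) =
      {(phase 5 (start_state X), keep (replicate k 0) @ (0, MoveRight) # keep (replicate (kX - Suc 0) 0))}"
    unfolding rules_at_def log_machine_def Let_def by auto
  have "{c'. step LM {} (phase 4 0, ms @ tape_of v (int 0 - 1) # blanks (kX - Suc 0)) c'} =
      {(phase 5 (start_state X), ms @ start_tapes kX v)}"
    by (simp add: succs_rules_at at assms(2) embed_step_def act_tape_of len map2_act_blanks[OF assms(2)]
        start_tapes_def input_tape_eq)
  from runs_one[OF _ this] log_phase5[OF assms(1) _ assms(2)] X show ?case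
    by (simp add: start_tapes_def)
next
  have len: "length ms = k" using arg_cong[OF assms(2), of length] by simp
  case (Suc h)
  then obtain v1 b v2 where v: "v = v1 @ b # v2" "length v1 = h"
    by (metis Suc_le_lessD id_take_nth_drop length_take min.absorb4)
  have at: "rules_at LM (phase 4 0) (replicate k 0 @ bit_symbol b # replicate (kX - Suc 0) 0) =
      {(phase 4 0, keep (replicate k 0) @ (bit_symbol b, MoveLeft) # keep (replicate (kX - Suc 0) 0))}"
    unfolding rules_at_def log_machine_def Let_def by auto
  have "{c'. step LM {} (phase 4 0, ms @ tape_of v (int (Suc h) - 1) # blanks (kX - Suc 0)) c'} =
      {(phase 4 0, ms @ tape_of v (int h - 1) # blanks (kX - Suc 0))}"
    unfolding v(1) v(2)[symmetric]
    by (simp add: succs_rules_at at assms(2) embed_step_def act_tape_of len map2_act_blanks[OF assms(2)])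
  from runs_one[OF _ this Suc.IH] Suc.prems show ?case by simp
qed

text \<open>\<open>L\<close> bounds the log including the choices still to come, so that one time
  bound \<open>N\<close> for \<open>X\<close> serves all branches; \<open>L + 1\<close> pays for
  rewinding the log.\<close>

lemma log_phase3:
  assumes "halts \<delta> c n" "length (snd c) = k" "fst c \<noteq> a" "length l + n \<le> L"
    and X: "\<And>v. length v \<le> L \<Longrightarrow> runs X {} (start_state X, start_tapes kX v) N (h v)"
  shows "runs LM {} (phase 3 (fst c), snd c @ tape_of l (int (length l)) # blanks (kX - Suc 0))
    (n + (N + L + 1)) (\<Sum>u\<in>witnesses \<delta> a (Some c). h (l @ u))"
  using assms(1-4)
proof (induction arbitrary: l rule: halts.induct)
  case (1 c n)
  let ?t = "tape_of l (int (length l))" and ?Z = "blanks (kX - Suc 0)"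
  let ?W = "\<lambda>b. witnesses \<delta> a (nxt \<delta> b c)"
  let ?g = "\<lambda>b c'. if fst c' = a
    then (phase 4 0, map2 act (keep (replicate k 0)) (snd c) @ act (bit_symbol b, Stay) ?t # ?Z)
    else (phase 3 (fst c'), snd c' @ act (bit_symbol b, MoveRight) ?t # ?Z)"
  let ?F = "\<lambda>b (q', as). log_step k kX a b q' as"
  have at: "rules_at LM (phase 3 q) (rs @ 0 # replicate (kX - Suc 0) 0) =
      (\<Union>b. ?F b ` set_option (\<delta> b (q, rs)))" for q rs
  proof (intro set_eqI)
    fix y
    have "y \<in> rules_at LM (phase 3 q) (rs @ 0 # replicate (kX - Suc 0) 0) \<longleftrightarrow>
        (\<exists>b q' as. \<delta> b (q, rs) = Some (q', as) \<and> y = log_step k kX a b q' as)"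
      unfolding rules_at_def log_machine_def Let_def by (cases y) auto
    also have "\<dots> \<longleftrightarrow> y \<in> (\<Union>b. ?F b ` set_option (\<delta> b (q, rs)))"
      unfolding UN_iff image_iff Bex_def by (auto simp: split_paired_Ex)
    finally show "y \<in> rules_at LM (phase 3 q) (rs @ 0 # replicate (kX - Suc 0) 0) \<longleftrightarrow> \<dots>" .
  qed
  have emb: "embed_step (snd c @ ?t # ?Z) (?F b y) = ?g b (embed_step (snd c) y)"
    if "y \<in> set_option (\<delta> b (fst c, map read_tape (snd c)))" for b y
  proof -
    obtain q' as where y: "y = (q', as)" by (cases y)
    with that have "length as = k" using normal_form_rule[OF nf] by simp
    with y 1(3) show ?thesis by (simp add: embed_step_def log_step_def)
  qed
  have "{c'. step LM {} (phase 3 (fst c), snd c @ ?t # ?Z) c'} =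
      (\<Union>b. (\<lambda>y. embed_step (snd c @ ?t # ?Z) (?F b y)) ` set_option (\<delta> b (fst c, map read_tape (snd c))))"
    by (simp add: succs_rules_at at image_UN image_image)
  also have "\<dots> = (\<Union>b. (\<lambda>y. ?g b (embed_step (snd c) y)) ` set_option (\<delta> b (fst c, map read_tape (snd c))))"
    by (intro SUP_cong image_cong refl emb)
  also have "\<dots> = (\<Union>b. ?g b ` set_option (nxt \<delta> b c))"
    by (simp only: nxt_def option.set_map image_image)
  also have "\<dots> = set_option (map_option (?g False) (nxt \<delta> False c)) \<union> set_option (map_option (?g True) (nxt \<delta> True c))"
    by (simp only: UNIV_bool UN_insert UN_empty option.set_map Un_empty_right)
  finally have succ: "{c'. step LM {} (phase 3 (fst c), snd c @ ?t # ?Z) c'} = \<dots>" .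
  have fin: "finite (?W b)" for b
    by (cases "nxt \<delta> b c") (auto intro: finite_witnesses 1(1))
  have sub: "runs LM {} d (n + (N + L + 1)) (\<Sum>u\<in>?W b. h (l @ b # u))"
    if "map_option (?g b) (nxt \<delta> b c) = Some d" for b d
  proof -
    from that obtain c' where c': "nxt \<delta> b c = Some c'" "d = ?g b c'" by auto
    show ?thesis
    proof (cases "fst c' = a")
      case True
      \<comment> \<open>Entering \<open>a\<close> ends the simulated computation, so the log is
        complete with this bit.\<close>
      then have W: "?W b = {[]}"
        unfolding c'(1) by (subst witnesses_Some) (simp add: normal_form_None[OF nf])
      have "map read_tape (map2 act (keep (replicate k 0)) (snd c)) = replicate k 0"
        using 1(3) by (auto simp: keep_def intro!: nth_equalityI) (metis prod.collapse act.simps read_tape.simps fun_upd_same shift.simps(2) add.right_neutral)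
      moreover have "length (l @ [b]) \<le> L" using 1(5) by simp
      \<comment> \<open>The last bit is written without a head move, so the head already stands on
        the last letter, where the rewinding starts.\<close>
      moreover have "act (bit_symbol b, Stay) ?t = tape_of (l @ [b]) (int (length (l @ [b])) - 1)"
        by (simp add: act_append)
      ultimately have "runs LM {} d (N + length (l @ [b]) + 1) (h (l @ [b]))"
        using log_phase4[OF X, of "l @ [b]" _ "length (l @ [b])"] c' True by simp
      then have "runs LM {} d (n + (N + L + 1)) (h (l @ [b]))"
        by (rule runs_mono) (use 1(5) in simp)
      then show ?thesis unfolding W by simp
    next
      case False
      have "runs LM {} (phase 3 (fst c'), snd c' @ tape_of (l @ [b]) (int (length (l @ [b]))) # ?Z)
        (n + (N + L + 1)) (\<Sum>u\<in>witnesses \<delta> a (Some c'). h ((l @ [b]) @ u))"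
        by (rule 1(2)[OF c'(1) normal_form_length[OF nf c'(1) 1(3)] False]) (use 1(5) in simp)
      then show ?thesis using c' False by (simp add: act_append add.commute)
    qed
  qed
  have "(\<Sum>u\<in>witnesses \<delta> a (Some c). h (l @ u)) = (\<Sum>u\<in>(#) False ` ?W False \<union> (#) True ` ?W True. h (l @ u))"
    using 1(4) by (subst witnesses_Some) simp
  also have "\<dots> = (\<Sum>u\<in>?W False. h (l @ False # u)) + (\<Sum>u\<in>?W True. h (l @ True # u))"
    by (subst sum.union_disjoint) (use fin in \<open>auto simp: sum.reindex\<close>)
  finally have sum: "(\<Sum>u\<in>witnesses \<delta> a (Some c). h (l @ u)) = \<dots>" .
  have "runs LM {} (phase 3 (fst c), snd c @ ?t # ?Z) (Suc (n + (N + L + 1)))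
     ((\<Sum>u\<in>?W False. h (l @ False # u)) + (\<Sum>u\<in>?W True. h (l @ True # u)))"
  proof (rule runs_union[OF _ succ])
    \<comment> \<open>The two next states differ, so at most one of them is \<open>a\<close>: either
      the phases or the states distinguish the successors.\<close>
    show "set_option (map_option (?g False) (nxt \<delta> False c)) \<inter> set_option (map_option (?g True) (nxt \<delta> True c)) = {}"
      using normal_form_distinct[OF nf, of c] by (auto simp: option.set_map elim!: option.set_cases split: if_splits)
  qed (use sub in auto)
  then show ?case unfolding sum by simp
qed

lemma log_phase2:
  assumes "runs LM {} (phase 3 s, tape_of w 0 # blanks (k - Suc 0) @ t # blanks (kX - Suc 0)) n m"
    "read_tape t = 0" "h \<le> length w"
  shows "runs LM {} (phase 2 0, tape_of w (int h - 1) # blanks (k - Suc 0) @ t # blanks (kX - Suc 0)) (n + h + 1) m"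
  using assms(3)
proof (induction h)
  have t: "act (0, Stay) t = t" using act_stay[of t] assms(2) by simp
  case 0
  have at: "rules_at LM (phase 2 0) (0 # replicate (k - Suc 0) 0 @ 0 # replicate (kX - Suc 0) 0) =
      {(phase 3 s, (0, MoveRight) # keep (replicate (k - Suc 0) 0) @ (0, Stay) # keep (replicate (kX - Suc 0) 0))}"
    unfolding rules_at_def log_machine_def Let_def by auto
  have "{c'. step LM {} (phase 2 0, tape_of w (int 0 - 1) # blanks (k - Suc 0) @ t # blanks (kX - Suc 0)) c'} =
      {(phase 3 s, tape_of w 0 # blanks (k - Suc 0) @ t # blanks (kX - Suc 0))}"
    by (simp add: succs_rules_at at assms(2) embed_step_def act_tape_of t)
  from runs_one[OF _ this assms(1)] show ?case by simp
next
  have t: "act (0, Stay) t = t" using act_stay[of t] assms(2) by simp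
  case (Suc h)
  then obtain w1 b w2 where w: "w = w1 @ b # w2" "length w1 = h"
    by (metis Suc_le_lessD id_take_nth_drop length_take min.absorb4)
  have at: "rules_at LM (phase 2 0) (bit_symbol b # replicate (k - Suc 0) 0 @ 0 # replicate (kX - Suc 0) 0) =
      {(phase 2 0, (bit_symbol b, MoveLeft) # keep (replicate (k - Suc 0) 0) @ (0, Stay) # keep (replicate (kX - Suc 0) 0))}"
    unfolding rules_at_def log_machine_def Let_def by auto
  have "{c'. step LM {} (phase 2 0, tape_of w (int (Suc h) - 1) # blanks (k - Suc 0) @ t # blanks (kX - Suc 0)) c'} =
      {(phase 2 0, tape_of w (int h - 1) # blanks (k - Suc 0) @ t # blanks (kX - Suc 0))}"
    unfolding w(1) w(2)[symmetric]
    by (simp add: succs_rules_at at assms(2) embed_step_def act_tape_of t)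
  from runs_one[OF _ this Suc.IH] Suc.prems show ?case by simp
qed

lemma log_phase0:
  assumes "runs LM {} (phase 2 0, tape_of (w1 @ w2) (int (length (w1 @ w2)) - 1) # blanks (k - Suc 0) @
      tape_of (l @ encode w2 []) (int (length (l @ encode w2 []))) # blanks (kX - Suc 0)) n m"
  shows "runs LM {} (phase 0 0, tape_of (w1 @ w2) (int (length w1)) # blanks (k - Suc 0) @
      tape_of l (int (length l)) # blanks (kX - Suc 0)) (n + 2 * length w2 + 1) m"
  using assms
proof (induction w2 arbitrary: w1 l)
  case Nil
  have at: "rules_at LM (phase 0 0) (0 # replicate (k - Suc 0) 0 @ 0 # replicate (kX - Suc 0) 0) =
      {(phase 2 0, (0, MoveLeft) # keep (replicate (k - Suc 0) 0) @ (bit_symbol False, MoveRight) # keep (replicate (kX - Suc 0) 0))}"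
    unfolding rules_at_def log_machine_def Let_def by auto
  have "{c'. step LM {} (phase 0 0, tape_of (w1 @ []) (int (length w1)) # blanks (k - Suc 0) @
      tape_of l (int (length l)) # blanks (kX - Suc 0)) c'} =
      {(phase 2 0, tape_of (w1 @ []) (int (length (w1 @ [])) - 1) # blanks (k - Suc 0) @
        tape_of (l @ encode [] []) (int (length (l @ encode [] []))) # blanks (kX - Suc 0))}"
    by (simp add: succs_rules_at at embed_step_def act_tape_of act_append add.commute)
  from runs_one[OF _ this Nil] show ?case by simp
next
  case (Cons x w2)
  have at0: "rules_at LM (phase 0 0) (bit_symbol x # replicate (k - Suc 0) 0 @ 0 # replicate (kX - Suc 0) 0) =
      {(phase 1 0, (bit_symbol x, Stay) # keep (replicate (k - Suc 0) 0) @ (bit_symbol True, MoveRight) # keep (replicate (kX - Suc 0) 0))}"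
    and at1: "rules_at LM (phase 1 0) (bit_symbol x # replicate (k - Suc 0) 0 @ 0 # replicate (kX - Suc 0) 0) =
      {(phase 0 0, (bit_symbol x, MoveRight) # keep (replicate (k - Suc 0) 0) @ (bit_symbol x, MoveRight) # keep (replicate (kX - Suc 0) 0))}"
    unfolding rules_at_def log_machine_def Let_def by auto
  have succ0: "{c'. step LM {} (phase 0 0, tape_of (w1 @ x # w2) (int (length w1)) # blanks (k - Suc 0) @
      tape_of l (int (length l)) # blanks (kX - Suc 0)) c'} =
      {(phase 1 0, tape_of (w1 @ x # w2) (int (length w1)) # blanks (k - Suc 0) @
        tape_of (l @ [True]) (int (length (l @ [True]))) # blanks (kX - Suc 0))}"
    by (simp add: succs_rules_at at0 embed_step_def act_tape_of act_append add.commute)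
  have succ1: "{c'. step LM {} (phase 1 0, tape_of (w1 @ x # w2) (int (length w1)) # blanks (k - Suc 0) @
        tape_of (l @ [True]) (int (length (l @ [True]))) # blanks (kX - Suc 0)) c'} =
      {(phase 0 0, tape_of ((w1 @ [x]) @ w2) (int (length (w1 @ [x]))) # blanks (k - Suc 0) @
        tape_of (l @ [True, x]) (int (length (l @ [True, x]))) # blanks (kX - Suc 0))}"
    unfolding succs_rules_at[OF log_machine_simps(4)] list.map map_append tape_of_read_nth tape_of_read_end
      map_read_blanks at1
    by (simp add: embed_step_def act_tape_of(1) act_append[of x MoveRight "l @ [True]", simplified] add.commute)
  have "runs LM {} (phase 0 0, tape_of ((w1 @ [x]) @ w2) (int (length (w1 @ [x]))) # blanks (k - Suc 0) @
        tape_of (l @ [True, x]) (int (length (l @ [True, x]))) # blanks (kX - Suc 0)) (n + 2 * length w2 + 1) m"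
    by (rule Cons.IH) (use Cons.prems in simp)
  from runs_one[OF _ succ0 runs_one[OF _ succ1 this]] show ?case by simp
qed

lemma log_sum_sharpP:
  fixes p q :: "nat poly"
  assumes p: "\<And>w. halts \<delta> (s, start_tapes k w) (poly p (length w))"
    and q: "\<And>v. runs X {} (initial_config X v) (poly q (length v)) (h v)"
  shows "(\<lambda>w. \<Sum>u\<in>witnesses \<delta> a (Some (s, start_tapes k w)). h (encode w u)) \<in> sharpP"
proof -
  have k: "k \<ge> 1" "s \<noteq> a" using nf by (simp_all add: normal_form_def)
  have X: "kX \<ge> 1" using wfX by (simp add: wf_machine_def)
  \<comment> \<open>\<open>[:1, 2:]\<close> is the length of \<open>encode w []\<close>; at most
    \<open>p\<close> choices are appended to it.\<close>
  let ?L = "[:1, 2:] + p"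
  \<comment> \<open>\<open>X\<close> runs on words of length up to \<open>?L\<close>, hence the
    composition. \<open>[:3, 3:]\<close> pays for copying and rewinding the input.\<close>
  let ?q = "[:3, 3:] + p + (pcompose q ?L + ?L + 1)"
  have "runs LM {} (initial_config LM w) (poly ?q (length w))
      (\<Sum>u\<in>witnesses \<delta> a (Some (s, start_tapes k w)). h (encode w u))" for w
  proof -
    let ?n = "poly p (length w)" and ?l = "encode w []"
    let ?N = "poly q (poly ?L (length w))"
    have "runs X {} (start_state X, start_tapes kX v) ?N (h v)" if "length v \<le> poly ?L (length w)" for v
      using runs_mono[OF q poly_nat_mono[OF that]] by (simp add: initial_config_def start_tapes_def)
    from log_phase3[where c = "(s, start_tapes k w)" and l = ?l and L = "poly ?L (length w)", OF p _ _ _ this] k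
    have "runs LM {} (phase 3 s, tape_of w 0 # blanks (k - Suc 0) @ tape_of ?l (int (length ?l)) # blanks (kX - Suc 0))
        (?n + (?N + poly ?L (length w) + 1)) (\<Sum>u\<in>witnesses \<delta> a (Some (s, start_tapes k w)). h (?l @ u))"
      by (simp add: start_tapes_def input_tape_eq length_encode)
    from log_phase2[OF this _ order_refl]
    have "runs LM {} (phase 2 0, tape_of ([] @ w) (int (length ([] @ w)) - 1) # blanks (k - Suc 0) @
          tape_of ([] @ ?l) (int (length ([] @ ?l))) # blanks (kX - Suc 0))
        (?n + (?N + poly ?L (length w) + 1) + length w + 1) (\<Sum>u\<in>witnesses \<delta> a (Some (s, start_tapes k w)). h (?l @ u))"
      by simp
    from log_phase0[OF this]
    have "runs LM {} (phase 0 0, input_tape w # blanks (k - Suc 0) @ blank_tape # blanks (kX - Suc 0))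
        (?n + (?N + poly ?L (length w) + 1) + length w + 1 + 2 * length w + 1) (\<Sum>u\<in>witnesses \<delta> a (Some (s, start_tapes k w)). h (?l @ u))"
      by (simp add: input_tape_eq blank_tape_eq)
    moreover have "initial_config LM w = (phase 0 0, input_tape w # blanks (k - Suc 0) @ blank_tape # blanks (kX - Suc 0))"
    proof -
      have "blanks (k + kX - 1) = blanks ((k - Suc 0) + Suc (kX - Suc 0))" using k X by simp
      then show ?thesis by (simp add: initial_config_def replicate_add del: add_Suc_right)
    qed
    moreover have "h (?l @ u) = h (encode w u)" for u by (simp flip: encode_append)
    moreover have "?n + (?N + poly ?L (length w) + 1) + length w + 1 + 2 * length w + 1 \<le> poly ?q (length w)"
      by (simp add: poly_pcompose)
    ultimately show ?thesis using runs_mono by simp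
  qed
  then show ?thesis unfolding sharpP_iff using wf_log_machine by blast
qed

end

theorem sharpP_log_sum:
  assumes nf: "normal_form k \<delta> s a" and "h \<in> sharpP"
    and "\<And>w. halts \<delta> (s, start_tapes k w) (poly (p :: nat poly) (length w))"
  shows "(\<lambda>w. \<Sum>u\<in>witnesses \<delta> a (Some (s, start_tapes k w)). h (encode w u)) \<in> sharpP"
proof -
  obtain X and q :: "nat poly" where "wf_machine X" "oracle_free X"
    "\<forall>w. runs X {} (initial_config X w) (poly q (length w)) (h w)"
    using iffD1[OF sharpP_iff assms(2)] by blast
  then show ?thesis using log_sum_sharpP[OF nf _ _ assms(3)] by blast
qed

section \<open>Closure properties\<close>

text \<open>A machine has only one accepting state, so those of both summands are
  identified.\<close>

definition sum_state :: "nat \<Rightarrow> machine \<Rightarrow> nat \<Rightarrow> nat" where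
  "sum_state i M q = (if q = accept_state M then phase 0 (Suc 0) else phase (Suc i) q)"

lemma sum_state_eq [simp]: "sum_state i M q = sum_state i M q' \<longleftrightarrow> q = q'"
  "sum_state i M q = phase 0 (Suc 0) \<longleftrightarrow> q = accept_state M"
  "sum_state i M q \<noteq> phase 0 0" "phase 0 0 \<noteq> sum_state i M q"
  by (auto simp: sum_state_def)

lemma sum_state_neq [simp]:
  "i \<noteq> j \<Longrightarrow> q \<noteq> accept_state M \<Longrightarrow> sum_state i M q \<noteq> sum_state j N q'"
  by (auto simp: sum_state_def)

text \<open>
  The head move in the first step towards \<open>N\<close> keeps the two successors of the start apart even
  if both start states are accepting.
\<close>

definition sum_machine :: "machine \<Rightarrow> machine \<Rightarrow> machine" where
  "sum_machine M N = \<lparr>num_tapes = num_tapes M + num_tapes N, start_state = phase 0 0,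
     accept_state = phase 0 (Suc 0), oracle_states = None,
     rules = (let k = num_tapes M; l = num_tapes N in
       (\<lambda>x. (phase 0 0, x # replicate (k - Suc 0) 0 @ replicate l 0, sum_state 0 M (start_state M),
          (x, Stay) # keep (replicate (k - Suc 0) 0) @ keep (replicate l 0))) ` tape_symbols \<union>
       (\<lambda>x. (phase 0 0, x # replicate (k - Suc 0) 0 @ replicate l 0, sum_state (Suc 0) N (start_state N),
          (x, Stay) # (0, MoveRight) # keep (replicate (k - Suc 0) 0) @ keep (replicate (l - Suc 0) 0))) ` tape_symbols \<union>
       (\<lambda>(q, rs, q', as). (sum_state 0 M q, rs @ replicate l 0,
          sum_state 0 M q', as @ keep (replicate l 0))) ` rules M \<union>
       (\<lambda>(q, rs, q', as). (sum_state (Suc 0) N q, hd rs # replicate k 0 @ tl rs,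
          sum_state (Suc 0) N q', hd as # keep (replicate k 0) @ tl as)) ` rules N)\<rparr>"

context
  fixes M N :: machine
  assumes M: "wf_machine M" "oracle_free M" and N: "wf_machine N" "oracle_free N"
begin

abbreviation "SM \<equiv> sum_machine M N"
abbreviation "kM \<equiv> num_tapes M"
abbreviation "kN \<equiv> num_tapes N"

lemma sum_machine_simps [simp]:
  "num_tapes SM = kM + kN" "start_state SM = phase 0 0" "accept_state SM = phase 0 (Suc 0)"
  "oracle_states SM = None"
  by (simp_all add: sum_machine_def)

lemma sum_machine_rules:
  "(q, rs, q', as) \<in> rules M \<Longrightarrow> length rs = kM \<and> length as = kM \<and> q \<noteq> accept_state M"
  "(q, rs, q', as) \<in> rules N \<Longrightarrow> length rs = kN \<and> length as = kN \<and> q \<noteq> accept_state N"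
  "kM \<ge> 1" "kN \<ge> 1" "finite (rules M)" "finite (rules N)"
  using M N by (auto simp: wf_machine_def)

lemma wf_sum_machine: "wf_machine SM" "oracle_free SM"
proof -
  note rules = sum_machine_rules
  show "oracle_free SM" by (simp add: oracle_free_def)
  have "finite (rules SM)"
    unfolding sum_machine_def Let_def using rules(5,6) by simp
  moreover have "\<forall>(q, rs, q', as)\<in>rules SM.
      length rs = kM + kN \<and> length as = kM + kN \<and> q \<noteq> phase 0 (Suc 0)"
    unfolding sum_machine_def Let_def using rules(3,4) by (auto dest: rules(1,2))
  ultimately show "wf_machine SM" unfolding wf_machine_def using rules(3) by simp
qed

lemma sum_left:
  assumes "runs M {} c n m" "length (snd c) = kM"
  shows "runs SM {} (sum_state 0 M (fst c), snd c @ blanks kN) n m"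
proof -
  let ?E = "\<lambda>c :: config. (sum_state 0 M (fst c), snd c @ blanks kN)"
  have at: "rules_at SM (sum_state 0 M q) (rs @ replicate kN 0) =
      (\<lambda>(q', as). (sum_state 0 M q', as @ keep (replicate kN 0))) ` rules_at M q rs"
    if "q \<noteq> accept_state M" for q rs
    unfolding rules_at_def sum_machine_def Let_def using that by (auto simp: image_iff) force
  have step: "{c'. step SM {} (?E c) c'} = ?E ` {c'. step M {} c c'}"
    if "length (snd c) = kM" "fst c \<noteq> accept_state M" for c
  proof -
    obtain q ts where c: "c = (q, ts)" by (cases c)
    have len: "length as = kM" if "(q', as) \<in> rules_at M q rs" for q' as rs
      using that sum_machine_rules(1) by (auto simp: rules_at_def)
    have q: "q \<noteq> accept_state M" using that c by simp
    show ?thesis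
      unfolding c fst_conv snd_conv succs_rules_at[OF M(2)[unfolded oracle_free_def]]
        succs_rules_at[OF sum_machine_simps(4)] map_append map_read_blanks at[OF q] image_image
      by (rule image_cong) (use that c in \<open>auto simp: embed_step_def len\<close>)
  qed
  have "runs SM {} (?E c) n m"
    by (rule runs_embed[where I = "\<lambda>c. length (snd c) = kM", OF assms(1,2) step])
      (auto simp: inj_on_def prod_eq_iff dest: length_step[OF _ M(1)])
  then show ?thesis .
qed

text \<open>\<open>N\<close> shares the input tape and works on the last tapes, hence the cut into
  \<open>hd\<close> and \<open>tl\<close>. The tapes \<open>ts\<close> in between need only show
  blanks under their heads, because one of these heads was moved in the first step.\<close>

lemma sum_right:
  assumes "runs N {} c n m" "length (snd c) = kN" "map read_tape ts = replicate kM 0"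
  shows "runs SM {} (sum_state (Suc 0) N (fst c), hd (snd c) # ts @ tl (snd c)) n m"
proof -
  have lts: "length ts = kM" using arg_cong[OF assms(3), of length] by simp
  let ?E = "\<lambda>c :: config. (sum_state (Suc 0) N (fst c), hd (snd c) # ts @ tl (snd c))"
  have ne: "rs \<noteq> []" if "length rs = kN" for rs :: "'x list"
    using that sum_machine_rules(4) by auto
  have inj: "rs = rs'" if "hd rs = hd rs'" "tl rs = tl rs'" "length rs = kN" "length rs' = kN"
    for rs rs' :: "'x list"
    using that ne by (metis list.expand)
  have at: "rules_at SM (sum_state (Suc 0) N q) (hd rs # replicate kM 0 @ tl rs) =
      (\<lambda>(q', as). (sum_state (Suc 0) N q', hd as # keep (replicate kM 0) @ tl as)) ` rules_at N q rs"
    if "q \<noteq> accept_state N" "length rs = kN" for q rs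
  proof (intro set_eqI)
    fix y
    have "y \<in> rules_at SM (sum_state (Suc 0) N q) (hd rs # replicate kM 0 @ tl rs) \<longleftrightarrow>
        (\<exists>rs' q' as. (q, rs', q', as) \<in> rules N \<and> hd rs = hd rs' \<and> tl rs = tl rs' \<and>
          y = (sum_state (Suc 0) N q', hd as # keep (replicate kM 0) @ tl as))"
      unfolding rules_at_def sum_machine_def Let_def using that(1)
      by (cases y) (auto simp: image_iff split_paired_Ex Bex_def)
    also have "\<dots> \<longleftrightarrow> (\<exists>q' as. (q, rs, q', as) \<in> rules N \<and>
          y = (sum_state (Suc 0) N q', hd as # keep (replicate kM 0) @ tl as))"
      using inj that(2) sum_machine_rules(2) by metis
    finally show "y \<in> rules_at SM (sum_state (Suc 0) N q) (hd rs # replicate kM 0 @ tl rs) \<longleftrightarrow>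
        y \<in> (\<lambda>(q', as). (sum_state (Suc 0) N q', hd as # keep (replicate kM 0) @ tl as)) ` rules_at N q rs"
      by (auto simp: rules_at_def image_iff split_paired_Ex Bex_def)
  qed
  have step: "{c'. step SM {} (?E c) c'} = ?E ` {c'. step N {} c c'}"
    if "length (snd c) = kN" "fst c \<noteq> accept_state N" for c
  proof -
    have "snd c \<noteq> []" using that(1) ne by blast
    then obtain q t us where c: "c = (q, t # us)" by (metis list.exhaust prod.collapse)
    have len: "length as = kN" if "(q', as) \<in> rules_at N q rs" for q' as rs
      using that sum_machine_rules(2) by (auto simp: rules_at_def)
    have q: "q \<noteq> accept_state N" using that c by simp
    have read: "map read_tape (t # ts @ us) = hd (map read_tape (t # us)) # replicate kM 0 @ tl (map read_tape (t # us))"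
      using assms(3) by simp
    have "embed_step (t # ts @ us) (sum_state (Suc 0) N q', hd as # keep (replicate kM 0) @ tl as) =
        ?E (embed_step (t # us) (q', as))" if "(q', as) \<in> rules_at N q (map read_tape (t # us))" for q' as
    proof -
      have "as \<noteq> []" using len[OF that] ne by blast
      then obtain b bs where "as = b # bs" by (meson list.exhaust)
      then show ?thesis using lts by (simp add: embed_step_def map2_act_blanks[OF assms(3)])
    qed
    then show ?thesis
      unfolding c fst_conv snd_conv list.sel succs_rules_at[OF N(2)[unfolded oracle_free_def]]
        succs_rules_at[OF sum_machine_simps(4)] read
      by (subst at[OF q]) (use that(1) c in \<open>auto simp: image_image intro!: image_cong\<close>)
  qed
  have "runs SM {} (?E c) n m"
  proof (rule runs_embed[where I = "\<lambda>c. length (snd c) = kN", OF assms(1,2) step])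
    show "inj_on ?E {c. length (snd c) = kN}"
      by (rule inj_onI) (auto simp: prod_eq_iff intro: inj)
  qed (auto dest: length_step[OF _ N(1)])
  then show ?thesis .
qed

lemma sum_sharpP:
  fixes p q :: "nat poly"
  assumes p: "\<And>w. runs M {} (initial_config M w) (poly p (length w)) (f w)"
    and q: "\<And>w. runs N {} (initial_config N w) (poly q (length w)) (g w)"
  shows "(\<lambda>w. f w + g w) \<in> sharpP"
proof -
  note rules = sum_machine_rules
  have "runs SM {} (initial_config SM w) (poly (p + q + 1) (length w)) (f w + g w)" for w
  proof -
    let ?t = "input_tape w"
    let ?cM = "(sum_state 0 M (start_state M), ?t # blanks (kM - Suc 0) @ blanks kN)"
    let ?cN = "(sum_state (Suc 0) N (start_state N), ?t # (tape_of [] 1 # blanks (kM - Suc 0)) @ blanks (kN - Suc 0))"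
    let ?B = "poly p (length w) + poly q (length w)"
    have init: "initial_config SM w = (phase 0 0, ?t # blanks (kM - Suc 0) @ blanks kN)"
    proof -
      have "blanks (kM + kN - 1) = blanks ((kM - Suc 0) + kN)" using rules(3) by simp
      then show ?thesis by (simp add: initial_config_def replicate_add)
    qed
    have at: "rules_at SM (phase 0 0) (x # replicate (kM - Suc 0) 0 @ replicate kN 0) =
        {(sum_state 0 M (start_state M), (x, Stay) # keep (replicate (kM - Suc 0) 0) @ keep (replicate kN 0)),
         (sum_state (Suc 0) N (start_state N), (x, Stay) # (0, MoveRight) # keep (replicate (kM - Suc 0) 0) @ keep (replicate (kN - Suc 0) 0))}"
      if "x \<in> tape_symbols" for x
      unfolding rules_at_def sum_machine_def Let_def using that by auto
    have sym: "read_tape ?t \<in> tape_symbols" by (simp add: input_tape_eq read_tape_symbols)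
    \<comment> \<open>The tape after the input tape lies outside those of \<open>N\<close>, even if
      \<open>M\<close> has a single tape; its head makes the distinguishing move.\<close>
    have shift: "blanks (kM - Suc 0) @ blanks kN = blank_tape # blanks (kM - Suc 0) @ blanks (kN - Suc 0)"
    proof -
      have "blanks (kM - Suc 0) @ blanks kN = blanks (Suc ((kM - Suc 0) + (kN - Suc 0)))"
        using rules(4) by (simp flip: replicate_add)
      then show ?thesis by (simp add: replicate_add)
    qed
    have "embed_step (?t # blanks (kM - Suc 0) @ blanks kN)
        (sum_state (Suc 0) N (start_state N), (read_tape ?t, Stay) # (0, MoveRight) # keep (replicate (kM - Suc 0) 0) @ keep (replicate (kN - Suc 0) 0)) = ?cN"
      unfolding shift by (simp add: embed_step_def act_stay blank_tape_eq act_tape_of(2)[of _ "[]", simplified])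
        (simp flip: blank_tape_eq)
    moreover have "embed_step (?t # blanks (kM - Suc 0) @ blanks kN)
        (sum_state 0 M (start_state M), (read_tape ?t, Stay) # keep (replicate (kM - Suc 0) 0) @ keep (replicate kN 0)) = ?cM"
      by (simp add: embed_step_def act_stay)
    ultimately have succ: "{c'. step SM {} (initial_config SM w) c'} = {?cM, ?cN}"
      by (simp add: init succs_rules_at at[OF sym])
    have "?cM \<noteq> ?cN" unfolding shift by (simp add: tape_of_def blank_tape_eq)
    moreover have "runs SM {} ?cM (poly p (length w)) (f w)"
      using sum_left[OF p] rules(3) by (simp add: initial_config_def)
    then have "runs SM {} ?cM ?B (f w)" by (rule runs_mono) simp
    moreover have "runs SM {} ?cN (poly q (length w)) (g w)"
      using sum_right[OF q, where ts = "tape_of [] 1 # blanks (kM - Suc 0)"] rules(3,4)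
      by (simp add: initial_config_def read_tape_of flip: replicate_Suc)
    then have "runs SM {} ?cN ?B (g w)" by (rule runs_mono) simp
    ultimately have "runs SM {} (initial_config SM w) (Suc ?B) (f w + g w)"
      by (intro runs_two[OF _ succ]) (simp_all add: init)
    then show ?thesis by simp
  qed
  then show ?thesis unfolding sharpP_iff using wf_sum_machine by blast
qed

end

theorem sharpP_add:
  assumes "f \<in> sharpP" "g \<in> sharpP"
  shows "(\<lambda>w. f w + g w) \<in> sharpP"
proof -
  obtain M and p :: "nat poly" where "wf_machine M" "oracle_free M"
    "\<forall>w. runs M {} (initial_config M w) (poly p (length w)) (f w)"
    using iffD1[OF sharpP_iff assms(1)] by blast
  moreover obtain N and q :: "nat poly" where "wf_machine N" "oracle_free N"
    "\<forall>w. runs N {} (initial_config N w) (poly q (length w)) (g w)"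
    using iffD1[OF sharpP_iff assms(2)] by blast
  ultimately show ?thesis using sum_sharpP by blast
qed

section \<open>Functions on the natural numbers that preserve sharpP\<close>

definition sharpP_closed :: "(nat \<Rightarrow> nat) \<Rightarrow> bool" where
  "sharpP_closed S \<longleftrightarrow> (\<forall>f\<in>sharpP. (\<lambda>w. S (f w)) \<in> sharpP)"

lemma sharpP_closed_id: "sharpP_closed (\<lambda>n. n)"
  by (simp add: sharpP_closed_def)

lemma sharpP_closed_comp: "sharpP_closed S \<Longrightarrow> sharpP_closed T \<Longrightarrow> sharpP_closed (\<lambda>n. S (T n))"
  by (simp add: sharpP_closed_def)

lemma sharpP_closed_add: "sharpP_closed S \<Longrightarrow> sharpP_closed T \<Longrightarrow> sharpP_closed (\<lambda>n. S n + T n)"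
  by (simp add: sharpP_closed_def sharpP_add)

text \<open>Summation over the witnesses of \<open>f w\<close> is summation over their ranks \<open>0, \<dots>, f w - 1\<close>.\<close>

lemma sharpP_closed_sum:
  assumes "sharpP_closed S"
  shows "sharpP_closed (\<lambda>n. \<Sum>r<n. S r)"
  unfolding sharpP_closed_def
proof
  fix f assume "f \<in> sharpP"
  then obtain k \<delta> s a and p :: "nat poly" where nf: "normal_form k \<delta> s a" and
    p: "\<forall>w. halts \<delta> (s, start_tapes k w) (poly p (length w)) \<and>
      card (witnesses \<delta> a (Some (s, start_tapes k w))) = f w"
    using sharpP_normal_form by blast
  have h: "halts \<delta> (s, start_tapes k w) (poly p (length w))" for w using p by blast
  have "(\<lambda>v. S (decoded_rank k \<delta> s a v)) \<in> sharpP"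
    using assms decoded_rank_sharpP[OF nf h] by (simp add: sharpP_closed_def)
  from sharpP_log_sum[OF nf this h]
  have "(\<lambda>w. \<Sum>u\<in>witnesses \<delta> a (Some (s, start_tapes k w)). S (rank \<delta> a (s, start_tapes k w) u)) \<in> sharpP"
    by (simp add: decoded_rank_def[OF nf])
  moreover have "(\<Sum>u\<in>witnesses \<delta> a (Some (s, start_tapes k w)). S (rank \<delta> a (s, start_tapes k w) u)) =
      (\<Sum>r<f w. S r)" for w
    using sum_rank[OF nf h, where m = 0 and S = S] p by simp
  ultimately show "(\<lambda>w. \<Sum>r<f w. S r) \<in> sharpP" by simp
qed

text \<open>The support of a sharpP function is an NP language with the same machine. Finiteness of
  the path sets matters here, since \<open>card\<close> is 0 on infinite sets.\<close>

lemma sharpP_closed_pos: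
  assumes "\<And>L. L \<in> class_NP \<Longrightarrow> (\<lambda>w. of_bool (w \<in> L)) \<in> sharpP"
  shows "sharpP_closed (\<lambda>n. of_bool (0 < n))"
  unfolding sharpP_closed_def
proof
  fix f assume "f \<in> sharpP"
  then obtain M where M: "wf_machine M" "oracle_free M" "poly_time M {}"
    "f = (\<lambda>w. card (accepting_paths M {} w))"
    unfolding sharpP_def by blast
  have NP: "{w. accepting_paths M {} w \<noteq> {}} \<in> class_NP"
    unfolding class_NP_def using M by blast
  have "0 < f w \<longleftrightarrow> w \<in> {w. accepting_paths M {} w \<noteq> {}}" for w
    using finite_accepting_paths[OF M(1,3)] M(4) by (simp add: card_gt_0_iff)
  then show "(\<lambda>w. of_bool (0 < f w)) \<in> sharpP" using assms[OF NP] by (simp only:)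
qed

text \<open>The linear coefficient is 1 + 1/2 + 1/3 and the quadratic one -1/2 - 1/2, from expanding
  \<open>x - C(x, 2) + C(x, 3)\<close>.\<close>

definition witness_poly :: "rat poly" where
  "witness_poly = [:0, 11/6, -1, 1/6:]"

text \<open>Truncated subtraction drops exactly the path of rank 0.\<close>

lemma sum_of_bool_pos: "(\<Sum>r<n. of_bool (0 < r)) = n - (1 :: nat)"
  by (induction n) (auto simp: of_bool_def)

text \<open>For x = m + 1, Pascal's rule cancels everything except 1 + C(m, 3), and the nested sum
  is C(m, 3). At 0 both sides vanish.\<close>

lemma witness_poly_eq:
  "poly witness_poly (of_nat n) = of_nat (of_bool (0 < n) + (\<Sum>r<n - 1. \<Sum>t<r. t))"
proof -
  have 1: "of_nat (\<Sum>t<r. t) = (of_nat r * (of_nat r - 1) / 2 :: rat)" for r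
    by (induction r) (simp_all add: field_simps)
  have 2: "of_nat (\<Sum>r<m. \<Sum>t<r. t) = (of_nat m * (of_nat m - 1) * (of_nat m - 2) / 6 :: rat)" for m
    by (induction m) (simp_all add: 1 field_simps del: of_nat_sum)
  show ?thesis
  proof (cases n)
    case (Suc m)
    have "poly witness_poly (of_nat (Suc m)) = 1 + (of_nat m * (of_nat m - 1) * (of_nat m - 2) / 6 :: rat)"
      by (simp add: witness_poly_def field_simps)
    then show ?thesis using Suc 2[of m] by (simp del: of_nat_sum)
  qed (simp add: witness_poly_def)
qed

lemma closure_property_witness_poly:
  assumes "\<And>L. L \<in> class_NP \<Longrightarrow> (\<lambda>w. of_bool (w \<in> L)) \<in> sharpP"
  shows "closure_property witness_poly"
proof -
  have pos: "sharpP_closed (\<lambda>n. of_bool (0 < n))"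
    by (rule sharpP_closed_pos) (rule assms)
  have "sharpP_closed (\<lambda>n. n - 1)"
    using sharpP_closed_sum[OF pos] by (simp add: sum_of_bool_pos)
  from sharpP_closed_add[OF pos sharpP_closed_comp[OF sharpP_closed_sum[OF sharpP_closed_sum[OF sharpP_closed_id]] this]]
  have g: "(\<lambda>w. of_bool (0 < f w) + (\<Sum>r<f w - 1. \<Sum>t<r. t)) \<in> sharpP" if "f \<in> sharpP" for f
    using that by (simp only: sharpP_closed_def)
  show ?thesis
    unfolding closure_property_def comp_in_def witness_poly_eq
  proof
    fix f assume "f \<in> sharpP"
    show "\<exists>g\<in>sharpP. \<forall>w. rat_of_nat (of_bool (0 < f w) + (\<Sum>r<f w - 1. \<Sum>t<r. t)) = rat_of_nat (g w)"
      by (rule bexI[OF _ g[OF \<open>f \<in> sharpP\<close>]]) simp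
  qed
qed

section \<open>Oracle queries and diagonalization\<close>

text \<open>The relation serves two purposes: with \<open>Id\<close> the input itself is queried,
  with \<open>UNIV\<close> a guessed word of the same length. The state for a positive answer is the
  accepting one, and the state for a negative answer is a dead end.\<close>

definition query_machine :: "(bool \<times> bool) set \<Rightarrow> machine" where
  "query_machine R = \<lparr>num_tapes = 2, start_state = 0, accept_state = 2, oracle_states = Some (1, 2, 3),
     rules = (\<lambda>(x, y). (0, [bit_symbol x, 0], 0, [(bit_symbol x, MoveRight), (bit_symbol y, MoveRight)])) ` R \<union>
       {(0, [0, 0], 1, [(0, Stay), (0, Stay)])}\<rparr>"

lemma query_machine_simps [simp]:
  "num_tapes (query_machine R) = 2" "start_state (query_machine R) = 0"
  "accept_state (query_machine R) = 2" "oracle_states (query_machine R) = Some (1, 2, 3)"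
  by (simp_all add: query_machine_def)

lemma wf_query_machine: "wf_machine (query_machine R)"
proof -
  have "finite R" by (rule finite)
  then have "finite (rules (query_machine R))" by (simp add: query_machine_def)
  moreover have "\<forall>(q, rs, q', as)\<in>rules (query_machine R). length rs = 2 \<and> length as = 2 \<and> q = 0"
    by (auto simp: query_machine_def)
  ultimately show ?thesis by (fastforce simp: wf_machine_def)
qed

lemma succs_rule:
  assumes "oracle_states M = Some (qq, yes, no)" "q \<noteq> qq"
  shows "{c'. step M A (q, ts) c'} = embed_step ts ` rules_at M q (map read_tape ts)"
  using assms by (force simp: embed_step_def rules_at_def elim: step.cases intro: step.apply_rule)

lemma succs_query:
  assumes "oracle_states M = Some (q, yes, no)" "wf_machine M"
  shows "{c'. step M A (q, ts) c'} = {(if query_word (ts ! 1) \<in> A then yes else no, ts)}"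
proof -
  have none: "(q, rs, q', as) \<notin> rules M" for rs q' as
    using assms by (auto simp: wf_machine_def)
  have "c' = (if query_word (ts ! 1) \<in> A then yes else no, ts)" if "step M A (q, ts) c'" for c'
    using that by (cases rule: step.cases) (use none assms(1) in simp_all)
  moreover have "step M A (q, ts) (if query_word (ts ! 1) \<in> A then yes else no, ts)"
    using assms(1) by (rule step.oracle_call)
  ultimately show ?thesis by blast
qed

lemma query_word_tape_of: "query_word (tape_of l h) = l"
proof -
  let ?t = "fst (input_tape l)"
  have nth: "?t (int i) = (if i < length l then bit_symbol (l ! i) else 0)" for i
    by (simp add: input_tape_def)
  have "(LEAST n. ?t (int n) \<notin> range bit_symbol) = length l"
  proof (rule Least_equality)
    show "?t (int (length l)) \<notin> range bit_symbol" by (auto simp: nth)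
    show "length l \<le> n" if "?t (int n) \<notin> range bit_symbol" for n
      using that by (auto simp: nth split: if_splits)
  qed
  then have "query_word (tape_of l h) = map (\<lambda>i. ?t (int i) = bit_symbol True) [0..<length l]"
    by (simp add: tape_of_def)
  also have "\<dots> = map ((!) l) [0..<length l]" by (rule map_cong) (simp_all add: nth)
  finally show ?thesis by (simp only: map_nth)
qed

lemma finite_list_all2: "finite {y :: word. list_all2 P v y \<and> Q y}"
proof (rule finite_subset)
  show "{y :: word. list_all2 P v y \<and> Q y} \<subseteq> {y. set y \<subseteq> UNIV \<and> length y = length v}"
    by (auto dest: list_all2_lengthD)
qed (rule finite_lists_length_eq, simp)

lemma query_machine_runs:
  "runs (query_machine R) A (0, [tape_of (u @ v) (int (length u)), tape_of l (int (length l))])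
     (length v + 3) (card {y. list_all2 (\<lambda>x y. (x, y) \<in> R) v y \<and> l @ y \<in> A})"
proof (induction v arbitrary: u l)
  case Nil
  let ?ts = "[tape_of u (int (length u)), tape_of l (int (length l))]"
  have "rules_at (query_machine R) 0 [0, 0] = {(1, [(0, Stay), (0, Stay)])}"
    by (auto simp: rules_at_def query_machine_def)
  then have succ: "{c'. step (query_machine R) A (0, ?ts) c'} = {(1, ?ts)}"
    by (simp add: succs_rule embed_step_def act_tape_of)
  have query: "{c'. step (query_machine R) A (1, ?ts) c'} = {(if l \<in> A then 2 else 3, ?ts)}"
    using succs_query[OF query_machine_simps(4) wf_query_machine, of R A ?ts] by (simp add: query_word_tape_of)
  have "rules_at (query_machine R) 3 rs = {}" for rs
    by (auto simp: rules_at_def query_machine_def)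
  then have no: "{c'. step (query_machine R) A (3, ?ts) c'} = {}"
    by (simp add: succs_rule)
  have "{y. list_all2 (\<lambda>x y. (x, y) \<in> R) [] y \<and> l @ y \<in> A} = (if l \<in> A then {[]} else {})"
    by auto
  then have "runs (query_machine R) A (if l \<in> A then 2 else 3, ?ts) (Suc 0)
      (card {y. list_all2 (\<lambda>x y. (x, y) \<in> R) [] y \<and> l @ y \<in> A})"
    using runs_dead[OF _ no] by (auto intro: runs.accepting)
  from runs_one[OF _ succ runs_one[OF _ query this]] show ?case by (simp add: numeral_3_eq_3)
next
  case (Cons x v)
  let ?t = "tape_of (u @ x # v) (int (length u))" and ?l = "tape_of l (int (length l))"
  let ?c = "\<lambda>y. (0, [tape_of ((u @ [x]) @ v) (int (length (u @ [x]))), tape_of (l @ [y]) (int (length (l @ [y])))]) :: config"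
  let ?o = "\<lambda>y. if (x, y) \<in> R then Some (?c y) else None"
  let ?S = "\<lambda>y. {z. list_all2 (\<lambda>x y. (x, y) \<in> R) v z \<and> (l @ [y]) @ z \<in> A}"
  let ?k = "\<lambda>y. if (x, y) \<in> R then card (?S y) else 0"
  have at: "rules_at (query_machine R) 0 [bit_symbol x, 0] =
      (\<lambda>y. (0, [(bit_symbol x, MoveRight), (bit_symbol y, MoveRight)])) ` {y. (x, y) \<in> R}"
    by (auto simp: rules_at_def query_machine_def)
  have "{c'. step (query_machine R) A (0, [?t, ?l]) c'} = ?c ` {y. (x, y) \<in> R}"
    by (simp add: succs_rule at image_image embed_step_def act_tape_of act_append add.commute)
  also have "\<dots> = set_option (?o False) \<union> set_option (?o True)"
    by (auto simp: image_iff) (metis (full_types))+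
  finally have succ: "{c'. step (query_machine R) A (0, [?t, ?l]) c'} = \<dots>" .
  have IH: "runs (query_machine R) A (?c y) (length v + 3) (card (?S y))" for y
    by (rule Cons.IH)
  have "runs (query_machine R) A (0, [?t, ?l]) (Suc (length v + 3)) (?k False + ?k True)"
  proof (rule runs_union[OF _ succ])
    \<comment> \<open>The guessed letter is visible on the query tape, from which
      \<open>query_word\<close> recovers it.\<close>
    have "?c False \<noteq> ?c True"
    proof
      assume "?c False = ?c True"
      then have "tape_of (l @ [False]) (int (length l) + 1) = tape_of (l @ [True]) (int (length l) + 1)"
        by (simp add: add.commute)
      then have "l @ [False] = l @ [True]" by (metis query_word_tape_of)
      then show False by simp
    qed
    then show "set_option (?o False) \<inter> set_option (?o True) = {}" by (auto split: if_splits)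
    show "runs (query_machine R) A d (length v + 3) (?k False)" if "?o False = Some d" for d
      using that IH[of False] by (simp only: simp_thms option.inject option.distinct split: if_splits)
    show "runs (query_machine R) A d (length v + 3) (?k True)" if "?o True = Some d" for d
      using that IH[of True] by (simp only: simp_thms option.inject option.distinct split: if_splits)
  qed (simp_all split: if_splits)
  moreover have "card {y. list_all2 (\<lambda>x y. (x, y) \<in> R) (x # v) y \<and> l @ y \<in> A} = ?k False + ?k True"
  proof -
    have "{y. list_all2 (\<lambda>x y. (x, y) \<in> R) (x # v) y \<and> l @ y \<in> A} =
        (if (x, False) \<in> R then (#) False ` ?S False else {}) \<union> (if (x, True) \<in> R then (#) True ` ?S True else {})"
      (is "?L = ?R0 \<union> ?R1")
    proof (intro set_eqI)
      fix y
      show "y \<in> ?L \<longleftrightarrow> y \<in> ?R0 \<union> ?R1"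
      proof (cases y)
        case (Cons b z)
        then show ?thesis by (cases b) auto
      qed auto
    qed
    moreover have "card (?R0 \<union> ?R1) = card ?R0 + card ?R1"
      by (rule card_Un_disjoint) (auto intro: finite_imageI finite_list_all2)
    ultimately show ?thesis by (simp add: card_image)
  qed
  ultimately show ?case by simp
qed

lemma query_sharpP:
  "(\<lambda>w. card {y. list_all2 (\<lambda>x y. (x, y) \<in> R) w y \<and> y \<in> A}) \<in> sharpP_oracle A"
proof (rule sharpP_oracleI[OF wf_query_machine])
  fix w
  show "runs (query_machine R) A (initial_config (query_machine R) w) (poly [:3, 1:] (length w))
      (card {y. list_all2 (\<lambda>x y. (x, y) \<in> R) w y \<and> y \<in> A})"
    using query_machine_runs[of R A "[]" w "[]"]
    by (simp add: initial_config_def input_tape_eq blank_tape_eq add.commute)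
qed

text \<open>This is how a collapse of \<open>sharpP_NP\<close> is exploited: an NP language serves
  as its own oracle.\<close>

lemma characteristic_sharpP_oracle: "(\<lambda>w. of_bool (w \<in> A)) \<in> sharpP_oracle A"
proof -
  have "{y. list_all2 (\<lambda>x y. (x, y) \<in> Id) w y \<and> y \<in> A} = (if w \<in> A then {w} else {})" for w
    by (auto simp: list.rel_eq)
  then have eq: "card {y. list_all2 (\<lambda>x y. (x, y) \<in> Id) w y \<and> y \<in> A} = of_bool (w \<in> A)" for w by simp
  show ?thesis using query_sharpP[of Id A] unfolding eq .
qed

lemma count_length_sharpP_oracle: "(\<lambda>w. card {y \<in> A. length y = length w}) \<in> sharpP_oracle A"
proof -
  have eq: "{y. list_all2 (\<lambda>x y. (x, y) \<in> UNIV) w y \<and> y \<in> A} = {y \<in> A. length y = length w}" for w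
    by (auto simp: list_all2_conv_all_nth)
  show ?thesis using query_sharpP[of UNIV A] unfolding eq .
qed

section \<open>Characteristic functions of languages in P\<close>

lemma deterministic_card_accepting:
  assumes "wf_machine M" "oracle_free M" "deterministic M" "runs M A c n k"
  shows "k \<le> 1"
  using assms(4)
proof (induction rule: runs.induct)
  case (branching c n \<kappa>)
  obtain q ts where c: "c = (q, ts)" by (cases c)
  have "y = x" if "x \<in> rules_at M q rs" "y \<in> rules_at M q rs" for x y rs
    using that assms(3) unfolding rules_at_def deterministic_def by (cases x; cases y) blast
  then have "rules_at M q rs \<subseteq> {x}" if "x \<in> rules_at M q rs" for x rs
    using that by blast
  then have "{c'. step M A c c'} = {} \<or> (\<exists>d. {c'. step M A c c'} = {d})"
    unfolding c succs_rules_at[OF assms(2)[unfolded oracle_free_def]] by blast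
  then show ?case
  proof
    assume none: "{c'. step M A c c'} = {}"
    show ?thesis unfolding none by simp
  next
    assume "\<exists>d. {c'. step M A c c'} = {d}"
    then obtain d where d: "{c'. step M A c c'} = {d}" by blast
    then have "\<kappa> d \<le> 1" using branching.IH by blast
    then show ?thesis unfolding d by simp
  qed
qed simp

lemma characteristic_sharpP:
  assumes "L \<in> class_P"
  shows "(\<lambda>w. of_bool (w \<in> L)) \<in> sharpP"
proof -
  obtain M where M: "wf_machine M" "oracle_free M" "deterministic M" "poly_time M {}"
    "L = {w. accepting_paths M {} w \<noteq> {}}"
    using assms unfolding class_P_def by blast
  obtain p :: "nat poly" where p:
    "\<forall>w. runs M {} (initial_config M w) (poly p (length w)) (card (accepting_paths M {} w))"
    using poly_time_runs[OF M(1,4)] by blast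
  have "card (accepting_paths M {} w) = of_bool (w \<in> L)" for w
  proof -
    have "card (accepting_paths M {} w) \<le> 1"
      using p by (intro deterministic_card_accepting[OF M(1-3)]) blast
    moreover have "card (accepting_paths M {} w) = 0 \<longleftrightarrow> w \<notin> L"
      using finite_accepting_paths[OF M(1,4), of w] M(5) by simp
    ultimately show ?thesis by (cases "w \<in> L") simp_all
  qed
  then have "(\<lambda>w. of_bool (w \<in> L)) = (\<lambda>w. card (accepting_paths M {} w))" by simp
  then show ?thesis unfolding sharpP_def using M by blast
qed

section \<open>Dependence of computation paths on the oracle\<close>

definition queries :: "machine \<Rightarrow> config list \<Rightarrow> word set" where
  "queries M cs = (\<lambda>c. query_word (snd c ! 1)) ` {c \<in> set cs. \<exists>yes no. oracle_states M = Some (fst c, yes, no)}"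

lemma finite_queries [simp]: "finite (queries M cs)"
  by (simp add: queries_def)

lemma card_queries: "card (queries M cs) \<le> length cs"
proof -
  have "card (queries M cs) \<le> card {c \<in> set cs. \<exists>yes no. oracle_states M = Some (fst c, yes, no)}"
    unfolding queries_def by (rule card_image_le) simp
  also have "\<dots> \<le> card (set cs)" by (rule card_mono) auto
  also have "\<dots> \<le> length cs" by (rule card_length)
  finally show ?thesis .
qed

lemma step_agree:
  assumes "step M A c c'" "queries M [c] \<inter> A = queries M [c] \<inter> B"
  shows "step M B c c'"
  using assms(1)
proof cases
  case (apply_rule q ts q' as)
  show ?thesis unfolding apply_rule(1,2) using apply_rule(3) by (rule step.apply_rule)
next
  case (oracle_call q yes no ts)
  have "query_word (ts ! 1) \<in> queries M [c]"
    unfolding queries_def oracle_call(1) by (rule image_eqI[of _ _ "(q, ts)"]) (simp_all add: oracle_call(3))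
  then have "query_word (ts ! 1) \<in> A \<longleftrightarrow> query_word (ts ! 1) \<in> B" using assms(2) by blast
  then have "c' = (if query_word (ts ! 1) \<in> B then yes else no, ts)" using oracle_call(2) by simp
  then show ?thesis unfolding oracle_call(1) using step.oracle_call[OF oracle_call(3)] by metis
qed

lemma queries_append: "queries M (cs @ ds) = queries M cs \<union> queries M ds"
  unfolding queries_def by auto

lemma queries_mem: "c \<in> set cs \<Longrightarrow> queries M [c] \<subseteq> queries M cs"
  unfolding queries_def by auto

lemma paths_snoc:
  "cs @ [c'] \<in> paths_from M A c \<longleftrightarrow> (if cs = [] then c' = c else cs \<in> paths_from M A c \<and> step M A (last cs) c')"
  by (auto simp: paths_from_def successively_append_iff)

lemma paths_take: "cs \<in> paths_from M A c \<Longrightarrow> 0 < k \<Longrightarrow> take k cs \<in> paths_from M A c"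
  using successively_append_iff[of "step M A" "take k cs" "drop k cs"]
  by (simp add: paths_from_def)

lemma path_agree:
  assumes "cs \<in> paths_from M A c" "queries M cs \<inter> A = queries M cs \<inter> B"
  shows "cs \<in> paths_from M B c"
  using assms
proof (induction cs rule: rev_induct)
  case (snoc c' cs)
  show ?case
  proof (cases "cs = []")
    case False
    then have cs: "cs \<in> paths_from M A c" "step M A (last cs) c'"
      using snoc.prems(1) by (simp_all add: paths_snoc)
    have agree: "queries M cs \<inter> A = queries M cs \<inter> B"
      using snoc.prems(2) unfolding queries_append by blast
    have "queries M [last cs] \<inter> A = queries M [last cs] \<inter> B"
      using agree queries_mem[of "last cs" cs M] False by auto
    then show ?thesis using snoc.IH[OF cs(1) agree] step_agree[OF cs(2)] False by (simp add: paths_snoc)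
  qed (use snoc.prems in \<open>simp add: paths_from_def\<close>)
qed (simp add: paths_from_def)

text \<open>Agreement is assumed along the paths under \<open>A\<close> only. The induction first
  brings the prefix back to \<open>A\<close>, which makes its queries subject to the assumption, and
  then transfers the last step.\<close>

lemma path_agree_rev:
  assumes "cs \<in> paths_from M B c"
    and "\<And>ds. ds \<in> paths_from M A c \<Longrightarrow> queries M ds \<inter> A = queries M ds \<inter> B"
  shows "cs \<in> paths_from M A c"
  using assms(1)
proof (induction cs rule: rev_induct)
  case (snoc c' cs)
  show ?case
  proof (cases "cs = []")
    case False
    then have cs: "cs \<in> paths_from M A c" "step M B (last cs) c'"
      using snoc by (simp_all add: paths_snoc)
    have "queries M [last cs] \<inter> B = queries M [last cs] \<inter> A"
      using assms(2)[OF cs(1)] queries_mem[of "last cs" cs M] False by auto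
    then show ?thesis using cs step_agree[OF cs(2)] False by (simp add: paths_snoc)
  qed (use snoc.prems in \<open>simp add: paths_from_def\<close>)
qed (simp add: paths_from_def)

lemma finite_paths_from:
  assumes "wf_machine M"
  shows "finite {cs \<in> paths_from M A c. length cs \<le> n}"
proof (induction n arbitrary: c)
  case 0
  have "{cs \<in> paths_from M A c. length cs \<le> 0} = {}" by (auto simp: paths_from_def)
  then show ?case by (simp only: finite.emptyI)
next
  case (Suc n)
  have "{cs \<in> paths_from M A c. length cs \<le> Suc n} \<subseteq>
      insert [c] (\<Union>c'\<in>{c'. step M A c c'}. (#) c ` {cs \<in> paths_from M A c'. length cs \<le> n})"
  proof
    fix cs assume "cs \<in> {cs \<in> paths_from M A c. length cs \<le> Suc n}"
    then have cs: "cs \<in> paths_from M A c" "length cs \<le> Suc n" by simp_all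
    from cs(1) show "cs \<in> insert [c] (\<Union>c'\<in>{c'. step M A c c'}. (#) c ` {cs \<in> paths_from M A c'. length cs \<le> n})"
    proof (cases rule: paths_from_cases)
      case (2 c' ds)
      then have "cs \<in> (#) c ` {cs \<in> paths_from M A c'. length cs \<le> n}" using cs(2) by simp
      then show ?thesis using 2(1) by blast
    qed simp
  qed
  then show ?case by (rule finite_subset) (use Suc finite_step[OF assms] in blast)
qed

definition witness_fun :: "nat \<Rightarrow> nat" where
  "witness_fun n = of_bool (0 < n) + (\<Sum>r<n - 1. \<Sum>t<r. t)"

lemma witness_fun_values: "witness_fun 0 = 0" "witness_fun (Suc 0) = 1" "witness_fun (Suc (Suc 0)) = 1"
  by (simp_all add: witness_fun_def)

text \<open>The time bound is part of the requirement, so that the requirements are indexed by the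
  countably many pairs of machine and polynomial, and violating the bound also counts as
  failure.\<close>

definition computes_in_time :: "machine \<Rightarrow> nat poly \<Rightarrow> word set \<Rightarrow> bool" where
  "computes_in_time M p A \<longleftrightarrow> (\<forall>w. (\<forall>cs\<in>computation_paths M A w. length cs - 1 \<le> poly p (length w)) \<and>
     card (accepting_paths M A w) = witness_fun (card {y \<in> A. length y = length w}))"

lemma computes_in_time_length:
  "computes_in_time M p A \<Longrightarrow> cs \<in> paths_from M A (initial_config M w) \<Longrightarrow> length cs - 1 \<le> poly p (length w)"
  unfolding computes_in_time_def computation_paths_eq by blast

section \<open>Exponential against polynomial growth\<close>

lemma poly_nat_bound: "\<exists>C d. \<forall>n. poly (p :: nat poly) n \<le> C * (n + 1) ^ d"
proof (induction p)
  case (pCons a p)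
  then obtain C d where C: "\<And>n. poly p n \<le> C * (n + 1) ^ d" by blast
  have "poly (pCons a p) n \<le> (a + C) * (n + 1) ^ Suc d" for n
  proof -
    have "n * poly p n \<le> (n + 1) * (C * (n + 1) ^ d)" by (intro mult_le_mono C) simp
    moreover have "a * 1 \<le> a * (n + 1) ^ Suc d" by (intro mult_le_mono one_le_power) simp_all
    ultimately have "a + n * poly p n \<le> a * (n + 1) ^ Suc d + (n + 1) * (C * (n + 1) ^ d)" by linarith
    then show ?thesis by (simp add: algebra_simps)
  qed
  then show ?case by blast
qed auto

lemma square_le_exp: "4 \<le> j \<Longrightarrow> j * j \<le> (2 :: nat) ^ j"
proof (induction j rule: dec_induct)
  case (step j)
  have "4 * j \<le> j * j" using step.hyps by (intro mult_le_mono) simp_all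
  moreover have "Suc j * Suc j = j * j + 2 * j + 1" by simp
  ultimately have "Suc j * Suc j \<le> 2 * (j * j)" using step.hyps by linarith
  also have "\<dots> \<le> 2 ^ Suc j" using step.IH by simp
  finally show ?case .
qed simp

text \<open>For n = 2^j a power of n + 1 is bounded by a power of 2 whose exponent is linear in j,
  while n itself is at least j^2. Only exponents remain to be compared.\<close>

lemma exists_exp_gt_poly: "\<exists>n\<ge>m. 2 * (poly (p :: nat poly) n + 1) < 2 ^ n"
proof -
  obtain C d where C: "\<And>n. poly p n \<le> C * (n + 1) ^ d" using poly_nat_bound by blast
  \<comment> \<open>The sum of the factors \<open>C + 7\<close> and \<open>2 * d\<close> used below,
    so that they fit into \<open>j * j\<close>; the summand \<open>m\<close> ensures
    \<open>m \<le> n\<close>.\<close>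
  define j where "j = C + 2 * d + m + 7"
  define n where "n = (2 :: nat) ^ j"
  have exp: "C + 2 + (j + 1) * d < n"
  proof -
    have "(j + 1) * d \<le> j * (2 * d)" by (simp add: j_def)
    moreover have "C + 2 < j * (C + 7)"
    proof -
      have "C + 2 < 1 * (C + 7)" by simp
      also have "\<dots> \<le> j * (C + 7)" by (intro mult_le_mono) (simp_all add: j_def)
      finally show ?thesis .
    qed
    ultimately have "C + 2 + (j + 1) * d < j * (C + 7) + j * (2 * d)" by (intro add_less_le_mono)
    also have "\<dots> \<le> j * j"
      by (subst distrib_left[symmetric], rule mult_le_mono) (simp_all add: j_def)
    finally have "C + 2 + (j + 1) * d < j * j" .
    also have "\<dots> \<le> n" unfolding n_def by (rule square_le_exp) (simp add: j_def)
    finally show ?thesis .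
  qed
  have "n + 1 \<le> 2 ^ (j + 1)" by (simp add: n_def)
  then have "(n + 1) ^ d \<le> 2 ^ ((j + 1) * d)" unfolding power_mult by (rule power_mono) simp
  moreover have "C + 1 \<le> 2 ^ C" by (induction C) simp_all
  ultimately have "(C + 1) * (n + 1) ^ d \<le> 2 ^ C * 2 ^ ((j + 1) * d)" by (intro mult_le_mono)
  moreover have "poly p n + 1 \<le> (C + 1) * (n + 1) ^ d"
  proof -
    have "1 \<le> (n + 1) ^ d" by (rule one_le_power) simp
    with C[of n] have "poly p n + 1 \<le> C * (n + 1) ^ d + (n + 1) ^ d" by (rule add_mono)
    then show ?thesis by (simp add: add.commute)
  qed
  ultimately have "2 * (poly p n + 1) \<le> 2 * (2 ^ C * 2 ^ ((j + 1) * d))"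
    by (meson le_trans mult_le_mono2)
  also have "\<dots> = 2 ^ (C + 1 + (j + 1) * d)" by (simp add: power_add)
  also have "\<dots> < 2 ^ n" using exp by (intro power_strict_increasing) simp_all
  finally have "2 * (poly p n + 1) < 2 ^ n" .
  moreover have "m \<le> n"
  proof -
    have "m \<le> j" by (simp add: j_def)
    also have "j \<le> n" unfolding n_def by (rule less_imp_le) (rule less_exp)
    finally show ?thesis .
  qed
  ultimately show ?thesis by blast
qed

text \<open>Double counting in the digraph with an edge from \<open>y\<close> to each element of
  \<open>Q y\<close>: its at most m |Y| edges and their reversals cover all |Y|^2 pairs.\<close>

lemma card_symmetric_cover:
  assumes "finite Y" and "\<And>y. y \<in> Y \<Longrightarrow> finite (Q y) \<and> card (Q y) \<le> m"
    and "\<And>y z. y \<in> Y \<Longrightarrow> z \<in> Y \<Longrightarrow> z \<in> Q y \<or> y \<in> Q z"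
  shows "card Y \<le> 2 * m"
proof -
  let ?R = "Sigma Y (\<lambda>y. Q y \<inter> Y)"
  have fin: "finite ?R" using assms(1) by simp
  have "Y \<times> Y \<subseteq> ?R \<union> prod.swap ` ?R"
  proof
    fix x assume "x \<in> Y \<times> Y"
    then obtain y z where x: "x = (y, z)" "y \<in> Y" "z \<in> Y" by blast
    from assms(3)[OF x(2,3)] show "x \<in> ?R \<union> prod.swap ` ?R"
    proof
      assume "y \<in> Q z"
      then have "(z, y) \<in> ?R" using x by blast
      then have "prod.swap (z, y) \<in> prod.swap ` ?R" by (rule imageI)
      then show ?thesis using x by simp
    qed (use x in blast)
  qed
  then have "card (Y \<times> Y) \<le> card (?R \<union> prod.swap ` ?R)" using fin by (intro card_mono) auto
  also have "\<dots> \<le> card ?R + card (prod.swap ` ?R)" by (rule card_Un_le)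
  also have "card (prod.swap ` ?R) = card ?R" by (simp add: card_image)
  also have "card ?R = (\<Sum>y\<in>Y. card (Q y \<inter> Y))" using assms(1) by (simp add: card_SigmaI)
  also have "\<dots> \<le> (\<Sum>y\<in>Y. m)"
  proof (rule sum_mono)
    fix y assume "y \<in> Y"
    then have "card (Q y \<inter> Y) \<le> card (Q y)" using assms(2) by (intro card_mono) auto
    then show "card (Q y \<inter> Y) \<le> m" using assms(2) \<open>y \<in> Y\<close> by fastforce
  qed
  finally have "card Y * card Y \<le> card Y * m + card Y * m" by (simp add: card_cartesian_product)
  also have "\<dots> = card Y * (2 * m)" by (simp add: distrib_left mult_2)
  finally have "card Y * card Y \<le> card Y * (2 * m)" .
  then show ?thesis unfolding mult_le_cancel1 by linarith
qed

text \<open>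
  Suppose that \<open>M\<close> succeeds whichever set \<open>S\<close> of at most two words of length \<open>n\<close> the oracle has.
  The accepting path for \<open>{y}\<close> queries \<open>y\<close>, since there is none for the empty set. If the
  accepting paths for \<open>{y}\<close> and for \<open>{z}\<close> did not query \<open>z\<close> and \<open>y\<close>, respectively, then both would
  be accepting paths for \<open>{y, z}\<close>, which has only one. This forces too many queries.
\<close>

lemma diagonal_step:
  assumes wf: "wf_machine M" and F: "finite F"
  shows "\<exists>A' F'. finite F' \<and> F \<subseteq> F' \<and> A' \<inter> F = A \<inter> F \<and>
    (\<forall>B. B \<inter> F' = A' \<inter> F' \<longrightarrow> \<not> computes_in_time M p B)"
proof (rule ccontr)
  assume "\<not> ?thesis"
  then have contr: "\<exists>B. B \<inter> F' = A' \<inter> F' \<and> computes_in_time M p B"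
    if "finite F'" "F \<subseteq> F'" "A' \<inter> F = A \<inter> F" for A' F'
    using that by metis
  have "finite (length ` F)" using F by simp
  then obtain m where m: "\<And>y. y \<in> F \<Longrightarrow> length y < m"
    by (metis finite_nat_set_iff_bounded imageI)
  \<comment> \<open>\<open>n\<close> exceeds all lengths in \<open>F\<close>, so the words of length
    \<open>n\<close> are still undecided, and they are more than twice as many as a single path can
    query.\<close>
  obtain n where n: "m \<le> n" "2 * (poly p n + 1) < 2 ^ n" using exists_exp_gt_poly by blast
  define w where "w = replicate n False"
  define L where "L = poly p n"
  define Y where "Y = {y :: word. length y = n}"
  define A0 where "A0 = A - Y"
  have finY: "finite Y" and cardY: "card Y = 2 ^ n"
    using finite_lists_length_eq[of "UNIV :: bool set" n] card_lists_length_eq[of "UNIV :: bool set" n]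
    by (simp_all add: Y_def)
  have disj: "F \<inter> Y = {}" using m n(1) by (force simp: Y_def)
  let ?P = "\<lambda>A. paths_from M A (initial_config M w)"
  have key: "finite (accepting_paths M (A0 \<union> S) w) \<and> card (accepting_paths M (A0 \<union> S) w) = witness_fun (card S) \<and>
      (\<forall>cs\<in>accepting_paths M (A0 \<union> S) w. length cs \<le> L + 1)" if S: "S \<subseteq> Y" for S
  proof -
    let ?A = "A0 \<union> S"
    let ?PP = "{cs \<in> ?P ?A. length cs \<le> L + 2}"
    \<comment> \<open>Freezing all answers seen on short paths makes \<open>?A\<close> and every
      admissible \<open>B\<close> indistinguishable on input \<open>w\<close>. Freezing
      \<open>Y\<close> makes \<open>S\<close> the set of words of length \<open>n\<close> in
      \<open>B\<close>.\<close>
    let ?F = "F \<union> Y \<union> (\<Union>cs\<in>?PP. queries M cs)"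
    have "finite ?F" using F finY finite_paths_from[OF wf] by simp
    moreover have "F \<subseteq> ?F" by blast
    moreover have "?A \<inter> F = A \<inter> F" using disj S by (auto simp: A0_def)
    ultimately have "\<exists>B. B \<inter> ?F = ?A \<inter> ?F \<and> computes_in_time M p B" by (rule contr)
    then obtain B where B: "B \<inter> ?F = ?A \<inter> ?F" "computes_in_time M p B" by (elim exE conjE)
    have agree: "queries M cs \<inter> ?A = queries M cs \<inter> B" if "cs \<in> ?PP" for cs
    proof -
      have "queries M cs \<subseteq> ?F" using that by blast
      then show ?thesis using B(1) by blast
    qed
    have time: "length cs - 1 \<le> L" if "cs \<in> ?P B" for cs
      using computes_in_time_length[OF B(2) that] by (simp add: L_def w_def)
    have short: "length cs \<le> L + 1" if cs: "cs \<in> ?P ?A" for cs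
    proof (rule ccontr)
      assume long: "\<not> length cs \<le> L + 1"
      \<comment> \<open>One configuration more than the time bound allows. The queries of this
        prefix are frozen, so it would also be a path under \<open>B\<close>, which respects the
        bound.\<close>
      let ?ds = "take (L + 2) cs"
      have "?ds \<in> ?P ?A"
        using cs by (rule paths_take) simp
      then have "?ds \<in> ?PP" by simp
      from path_agree[OF \<open>?ds \<in> ?P ?A\<close> agree[OF this]] have "length ?ds - 1 \<le> L" by (rule time)
      then show False using long by simp
    qed
    have "?P ?A = ?P B"
    proof
      have PP: "cs \<in> ?PP" if "cs \<in> ?P ?A" for cs using short[OF that] that by simp
      show "?P ?A \<subseteq> ?P B" using path_agree agree PP by blast
      show "?P B \<subseteq> ?P ?A" using path_agree_rev agree PP by blast
    qed
    then have acc: "accepting_paths M ?A w = accepting_paths M B w"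
      by (simp add: accepting_paths_eq accepting_from_def)
    have "{y \<in> B. length y = length w} = S"
    proof -
      have "{y \<in> B. length y = length w} = (B \<inter> ?F) \<inter> Y" by (auto simp: Y_def w_def)
      also have "\<dots> = (?A \<inter> ?F) \<inter> Y" by (simp only: B(1))
      also have "\<dots> = S" using S by (auto simp: A0_def)
      finally show ?thesis .
    qed
    then have "card (accepting_paths M ?A w) = witness_fun (card S)"
      unfolding acc using B(2) by (simp add: computes_in_time_def)
    moreover have "poly_time M B" using B(2) unfolding computes_in_time_def poly_time_def by blast
    then have "finite (accepting_paths M ?A w)" unfolding acc by (rule finite_accepting_paths[OF wf])
    moreover have "\<forall>cs\<in>accepting_paths M ?A w. length cs \<le> L + 1"
      using short by (simp add: accepting_paths_eq accepting_from_def)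
    ultimately show ?thesis by blast
  qed
  have empty: "accepting_paths M A0 w = {}"
    using key[of "{}"] by (auto simp: witness_fun_values)
  have "\<exists>cs. cs \<in> accepting_paths M (A0 \<union> {y}) w" if "y \<in> Y" for y
  proof -
    have "card (accepting_paths M (A0 \<union> {y}) w) = 1"
      using key[of "{y}"] that by (simp add: witness_fun_values)
    then have "accepting_paths M (A0 \<union> {y}) w \<noteq> {}" by (metis card.empty zero_neq_one)
    then show ?thesis by blast
  qed
  then obtain P where P: "\<And>y. y \<in> Y \<Longrightarrow> P y \<in> accepting_paths M (A0 \<union> {y}) w" by metis
  have transfer: "cs \<in> accepting_paths M B w" if "cs \<in> accepting_paths M B' w"
    "queries M cs \<inter> B' = queries M cs \<inter> B" for cs B B'
    using that path_agree[of cs M B' "initial_config M w" B] by (simp add: accepting_paths_eq accepting_from_def)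
  have self: "y \<in> queries M (P y)" if "y \<in> Y" for y
  proof (rule ccontr)
    assume "y \<notin> queries M (P y)"
    then have "P y \<in> accepting_paths M A0 w" by (intro transfer[OF P[OF that]]) blast
    then show False using empty by simp
  qed
  have "z \<in> queries M (P y) \<or> y \<in> queries M (P z)" if yz: "y \<in> Y" "z \<in> Y" for y z
  proof (rule ccontr)
    assume no: "\<not> ?thesis"
    then have "y \<noteq> z" using self yz by blast
    have "P y \<in> accepting_paths M (A0 \<union> {y, z}) w" by (rule transfer[OF P[OF yz(1)]]) (use no in blast)
    moreover have "P z \<in> accepting_paths M (A0 \<union> {y, z}) w" by (rule transfer[OF P[OF yz(2)]]) (use no in blast)
    moreover have "card (accepting_paths M (A0 \<union> {y, z}) w) = 1"
      using key[of "{y, z}"] yz \<open>y \<noteq> z\<close> by (simp add: witness_fun_values)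
    \<comment> \<open>The common path would query \<open>y\<close> as \<open>P y\<close> and avoid
      it as \<open>P z\<close>.\<close>
    ultimately have "P y = P z" by (metis card_1_singletonE singletonD)
    then show False using self[OF yz(1)] no by simp
  qed
  moreover have "finite (queries M (P y)) \<and> card (queries M (P y)) \<le> L + 1" if "y \<in> Y" for y
    using key[of "{y}"] P[OF that] that card_queries[of M "P y"] by force
  ultimately have "card Y \<le> 2 * (L + 1)" by (intro card_symmetric_cover[OF finY, of "\<lambda>y. queries M (P y)"]) blast+
  then show False using n(2) cardY by (simp add: L_def)
qed

section \<open>Construction of the diagonal oracle\<close>

instance dir :: countable
  by countable_datatype

text \<open>A finite extension argument: each stage holds an oracle together with a finite set of
  words on which it is settled for good, and defeats one requirement whatever happens outside that
  set.\<close>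

lemma diagonal_oracle: "\<exists>A. \<forall>M p. wf_machine M \<longrightarrow> \<not> computes_in_time M p A"
proof -
  \<comment> \<open>A well-formed machine has finitely many rules, hence is coded by a list of them,
    and a polynomial by its coefficients.\<close>
  define code :: "nat \<Rightarrow> (nat \<times> nat \<times> nat \<times> (nat \<times> nat \<times> nat) option \<times> rule list) \<times> nat list"
    where "code = from_nat"
  define mach where "mach = (\<lambda>i. case code i of ((k, s, a, orc, rl), _) \<Rightarrow>
    \<lparr>num_tapes = k, start_state = s, accept_state = a, oracle_states = orc, rules = set rl\<rparr>)"
  define time where "time = (\<lambda>i. Poly (snd (code i)))"
  have surj: "\<exists>i. mach i = M \<and> time i = p" if "wf_machine M" for M p
  proof -
    have "finite (rules M)" using that by (simp add: wf_machine_def)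
    then obtain rl where "set rl = rules M" using finite_list by blast
    then have "mach (to_nat ((num_tapes M, start_state M, accept_state M, oracle_states M, rl), coeffs p)) = M \<and>
        time (to_nat ((num_tapes M, start_state M, accept_state M, oracle_states M, rl), coeffs p)) = p"
      by (simp add: mach_def time_def code_def)
    then show ?thesis by blast
  qed
  have "\<exists>f :: nat \<Rightarrow> word set \<times> word set. \<forall>i. finite (snd (f i)) \<and>
      (snd (f i) \<subseteq> snd (f (Suc i)) \<and> fst (f (Suc i)) \<inter> snd (f i) = fst (f i) \<inter> snd (f i) \<and>
       (wf_machine (mach i) \<longrightarrow> (\<forall>B. B \<inter> snd (f (Suc i)) = fst (f (Suc i)) \<inter> snd (f (Suc i)) \<longrightarrow>
          \<not> computes_in_time (mach i) (time i) B)))"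
  proof (rule dependent_nat_choice)
    show "\<exists>x :: word set \<times> word set. finite (snd x)" by (rule exI[of _ "({}, {})"]) simp
    fix x :: "word set \<times> word set" and i
    assume x: "finite (snd x)"
    show "\<exists>y. finite (snd y) \<and> (snd x \<subseteq> snd y \<and> fst y \<inter> snd x = fst x \<inter> snd x \<and>
       (wf_machine (mach i) \<longrightarrow> (\<forall>B. B \<inter> snd y = fst y \<inter> snd y \<longrightarrow>
          \<not> computes_in_time (mach i) (time i) B)))"
    proof (cases "wf_machine (mach i)")
      case True
      obtain A' F' where "finite F'" "snd x \<subseteq> F'" "A' \<inter> snd x = fst x \<inter> snd x"
        "\<forall>B. B \<inter> F' = A' \<inter> F' \<longrightarrow> \<not> computes_in_time (mach i) (time i) B"
        using diagonal_step[OF True x] by metis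
      then show ?thesis by (intro exI[of _ "(A', F')"]) simp
    next
      case False
      then show ?thesis using x by blast
    qed
  qed
  then obtain f :: "nat \<Rightarrow> word set \<times> word set" where
    sub: "\<And>i. snd (f i) \<subseteq> snd (f (Suc i))" and
    ext: "\<And>i. fst (f (Suc i)) \<inter> snd (f i) = fst (f i) \<inter> snd (f i)" and
    bad: "\<And>i B. wf_machine (mach i) \<Longrightarrow> B \<inter> snd (f (Suc i)) = fst (f (Suc i)) \<inter> snd (f (Suc i)) \<Longrightarrow>
      \<not> computes_in_time (mach i) (time i) B"
    by metis
  have ext': "snd (f i) \<subseteq> snd (f (i + d)) \<and> fst (f (i + d)) \<inter> snd (f i) = fst (f i) \<inter> snd (f i)" for i d
  proof (induction d)
    case (Suc d)
    then show ?case using sub[of "i + d"] ext[of "i + d"] by auto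
  qed simp
  \<comment> \<open>Only the settled part of each stage is kept. Later stages never revise it, so
    \<open>A\<close> agrees with every stage on its settled words.\<close>
  define A where "A = (\<Union>i. fst (f i) \<inter> snd (f i))"
  have "A \<inter> snd (f j) = fst (f j) \<inter> snd (f j)" for j
  proof
    show "A \<inter> snd (f j) \<subseteq> fst (f j) \<inter> snd (f j)"
    proof
      fix x assume "x \<in> A \<inter> snd (f j)"
      then obtain i where "x \<in> fst (f i) \<inter> snd (f i)" "x \<in> snd (f j)" by (auto simp: A_def)
      then show "x \<in> fst (f j) \<inter> snd (f j)"
        using ext'[of i j] ext'[of j i] by (auto simp: add.commute)
    qed
  qed (auto simp: A_def)
  then have "\<not> computes_in_time M p A" if "wf_machine M" for M p
    using surj[OF that, of p] bad that by metis
  then show ?thesis by blast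
qed

lemma not_relativizes_witness_poly: "\<not> relativizes witness_poly"
proof
  assume rel: "relativizes witness_poly"
  obtain A where A: "\<And>M p. wf_machine M \<Longrightarrow> \<not> computes_in_time M p A" using diagonal_oracle by blast
  let ?f = "\<lambda>w. card {y \<in> A. length y = length w}"
  have "comp_in witness_poly ?f (sharpP_oracle A)"
    using rel count_length_sharpP_oracle unfolding relativizes_def by blast
  then obtain M where M: "wf_machine M" "poly_time M A"
    "\<forall>w. poly witness_poly (of_nat (?f w)) = of_nat (card (accepting_paths M A w))"
    unfolding comp_in_def sharpP_oracle_def by blast
  obtain p :: "nat poly" where "\<forall>w. \<forall>cs\<in>computation_paths M A w. length cs - 1 \<le> poly p (length w)"
    using M(2) unfolding poly_time_def by blast
  moreover have "card (accepting_paths M A w) = witness_fun (?f w)" for w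
    using M(3) unfolding witness_poly_eq of_nat_eq_iff witness_fun_def by simp
  ultimately have "computes_in_time M p A" by (simp add: computes_in_time_def)
  then show False using A[OF M(1)] by blast
qed

theorem theorem4p7:
  assumes "univariate_binomial_basis_conjecture"
  shows "sharpP \<noteq> sharpP_NP \<and> class_P \<noteq> class_NP"
proof (rule ccontr)
  assume "\<not> ?thesis"
  then consider "sharpP = sharpP_NP" | "class_P = class_NP" by blast
  then have "(\<lambda>w. of_bool (w \<in> L)) \<in> sharpP" if "L \<in> class_NP" for L
  proof cases
    case 1
    then show ?thesis using characteristic_sharpP_oracle[of L] that unfolding sharpP_NP_def by blast
  next
    case 2
    then show ?thesis using characteristic_sharpP that by blast
  qed
  then have "closure_property witness_poly" by (rule closure_property_witness_poly)
  then show False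
    using assms not_relativizes_witness_poly unfolding univariate_binomial_basis_conjecture_def by blast
qed

end
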